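(* Let $\mathcal K$, $(\mathsf Z_k,\mathcal A_k,\Psi_k,\Phi_k)_{k\in\mathcal K}$, $(\mathsf X,\mathcal B,\Pi)$ be as in the context, with $\mathcal K$ finite, and let $P$ be a Markov transition kernel on $(\mathsf X,\mathcal B)$ with $\Pi P=\Pi$. Assume: (H1) There is a positive integer $t$ such that for every $k\in\mathcal K$ there is a Markov transition kernel $P_k:\mathsf Z_k\times\mathcal A_k\to[0,1]$ with (i) $\Phi_kP_k=\Phi_k$; (ii) $\|P_k^t\|_{\Phi_k}<1$, where $P_k^t$ is viewed as an operator on $L_0^2(\Phi_k)$; (iii) there is a constant $c_k>0$ such that $P((k,z),\{k\}\times A)\ge c_kP_k(z,A)$ for all $z\in\mathsf Z_k$, $A\in\mathcal A_k$. (H2) For some positive integer $s$, every entry of the matrix $\Gamma_P^s$ is positive. Then $\|P^t\|_{\Pi}<1$ (operator norm on $L_0^2(\Pi)$), and $P$ is $L^2(\Pi)$ geometrically convergent.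
   Context: Let $\mathcal K$ be a finite set. For each $k\in\mathcal K$ let $(\mathsf Z_k,\mathcal A_k)$ be a nonempty measurable space and $\Psi_k$ a nonzero finite measure on it; write $\Phi_k=\Psi_k/\Psi_k(\mathsf Z_k)$. Let $\mathsf X=\bigcup_{k\in\mathcal K}\{k\}\times\mathsf Z_k$, let $\mathcal B$ be the $\sigma$-algebra generated by the sets $\{k\}\times A$ with $k\in\mathcal K$, $A\in\mathcal A_k$, and let $\Pi$ be the probability measure on $(\mathsf X,\mathcal B)$ with $\Pi(\{k\}\times A)=\Psi_k(A)/\sum_{k'\in\mathcal K}\Psi_{k'}(\mathsf Z_{k'})$. For a probability space $(\mathsf Y,\mathcal F,\omega)$: $L^2(\omega)$ is the Hilbert space of square-integrable real functions (mod a.e. equality) with $\langle f,g\rangle_\omega=\int fg\,d\omega$, $\|f\|_\omega=\langle f,f\rangle_\omega^{1/2}$; $L_0^2(\omega)=\{f\in L^2(\omega):\int f\,d\omega=0\}$. A Markov transition kernel (Mtk) $T$ with $\omega T=\omega$ acts on $L_0^2(\omega)$ by $Tf(y)=\int T(y,dy')f(y')$, and $\|T\|_\omega=\sup_{f\in L_0^2(\omega)\setminus\{0\}}\|Tf\|_\omega/\|f\|_\omega$. $L_*^2(\omega)$ is the set of probability measures $\mu$ with $d\mu/d\omega\in L^2(\omega)$, and for such $\mu,\nu$, $\|\mu-\nu\|_\omega=\|d\mu/d\omega-d\nu/d\omega\|_\omega$. $T$ is $L^2(\omega)$ geometrically convergent if there are $\rho<1$ and $C:L_*^2(\omega)\to[0,\infty)$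 with $\|\mu T^t-\omega\|_\omega\le C(\mu)\rho^t$ for all $\mu\in L_*^2(\omega)$ and $t\ge0$. For $k,k'\in\mathcal K$, set $\gamma_{k,k'}=1$ if $\int_{\mathsf Z_k}\Psi_k(dz)P((k,z),\{k'\}\times\mathsf Z_{k'})>0$ and $\gamma_{k,k'}=0$ otherwise. Fixing an ordering $k_{(1)},\dots,k_{(|\mathcal K|)}$ of $\mathcal K$, $\Gamma_P$ is the $|\mathcal K|\times|\mathcal K|$ matrix with $(i,j)$ entry $\gamma_{k_{(i)},k_{(j)}}$. *)

theory Defs
  imports "HOL-Probability.Probability"
begin

definition normalize_measure :: "'a measure \<Rightarrow> 'a measure" where
  "normalize_measure M = scale_measure (1 / emeasure M (space M)) M"

definition union_space :: "('k::finite \<Rightarrow> 'z measure) \<Rightarrow> ('k \<times> 'z) measure" where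
  "union_space Psi = sigma (SIGMA k:UNIV. space (Psi k))
      {{k} \<times> A | k A. A \<in> sets (Psi k)}"

definition union_measure :: "('k::finite \<Rightarrow> 'z measure) \<Rightarrow> ('k \<times> 'z) measure" where
  "union_measure Psi = measure_of (SIGMA k:UNIV. space (Psi k))
      {{k} \<times> A | k A. A \<in> sets (Psi k)}
      (\<lambda>B. (\<Sum>k\<in>UNIV. emeasure (Psi k) (Pair k -` B \<inter> space (Psi k)))
             / (\<Sum>k\<in>UNIV. emeasure (Psi k) (space (Psi k))))"

definition markov_kernel :: "'a measure \<Rightarrow> ('a \<Rightarrow> 'a measure) \<Rightarrow> bool" where
  "markov_kernel M K \<longleftrightarrow> K \<in> M \<rightarrow>\<^sub>M prob_algebra M"

fun kernel_pow :: "'a measure \<Rightarrow> ('a \<Rightarrow> 'a measure) \<Rightarrow> nat \<Rightarrow> 'a \<Rightarrow> 'a measure" where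
  "kernel_pow M K 0 = (\<lambda>x. return M x)"
| "kernel_pow M K (Suc n) = (\<lambda>x. K x \<bind> kernel_pow M K n)"

definition kernel_apply :: "('a \<Rightarrow> 'a measure) \<Rightarrow> ('a \<Rightarrow> real) \<Rightarrow> 'a \<Rightarrow> real" where
  "kernel_apply K f = (\<lambda>y. \<integral>y'. f y' \<partial>K y)"

definition L2_norm :: "'a measure \<Rightarrow> ('a \<Rightarrow> real) \<Rightarrow> real" where
  "L2_norm M f = sqrt (\<integral>x. (f x)\<^sup>2 \<partial>M)"

definition L2 :: "'a measure \<Rightarrow> ('a \<Rightarrow> real) set" where
  "L2 M = {f. f \<in> borel_measurable M \<and> integrable M (\<lambda>x. (f x)\<^sup>2)}"

definition L2_0 :: "'a measure \<Rightarrow> ('a \<Rightarrow> real) set" where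
  "L2_0 M = {f \<in> L2 M. integrable M f \<and> (\<integral>x. f x \<partial>M) = 0}"

definition op_norm :: "'a measure \<Rightarrow> ('a \<Rightarrow> 'a measure) \<Rightarrow> ereal" where
  "op_norm M K = (SUP f \<in> {f \<in> L2_0 M. L2_norm M f \<noteq> 0}.
       ereal (L2_norm M (kernel_apply K f) / L2_norm M f))"

definition L2_star :: "'a measure \<Rightarrow> 'a measure set" where
  "L2_star M = {mu \<in> space (prob_algebra M). absolutely_continuous M mu \<and>
       (\<lambda>x. enn2real (RN_deriv M mu x)) \<in> L2 M}"

definition L2_dist :: "'a measure \<Rightarrow> 'a measure \<Rightarrow> 'a measure \<Rightarrow> real" where
  "L2_dist M mu nu = L2_norm M (\<lambda>x. enn2real (RN_deriv M mu x) - enn2real (RN_deriv M nu x))"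

definition L2_geometrically_convergent :: "'a measure \<Rightarrow> ('a \<Rightarrow> 'a measure) \<Rightarrow> bool" where
  "L2_geometrically_convergent M K \<longleftrightarrow>
     (\<exists>\<rho> < 1. \<exists>C :: 'a measure \<Rightarrow> real. (\<forall>mu \<in> L2_star M. C mu \<ge> 0) \<and>
        (\<forall>mu \<in> L2_star M. \<forall>t::nat. L2_dist M (mu \<bind> kernel_pow M K t) M \<le> C mu * \<rho> ^ t))"

definition gamma_mat :: "('k::finite \<Rightarrow> 'z measure) \<Rightarrow> ('k \<times> 'z \<Rightarrow> ('k \<times> 'z) measure) \<Rightarrow> 'k \<Rightarrow> 'k \<Rightarrow> nat" where
  "gamma_mat Psi P k k' =
     (if (\<integral>z. measure (P (k, z)) ({k'} \<times> space (Psi k')) \<partial>Psi k) > 0 then 1 else 0)"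

fun mat_pow :: "('k::finite \<Rightarrow> 'k \<Rightarrow> nat) \<Rightarrow> nat \<Rightarrow> 'k \<Rightarrow> 'k \<Rightarrow> nat" where
  "mat_pow G 0 = (\<lambda>i j. if i = j then 1 else 0)"
| "mat_pow G (Suc n) = (\<lambda>i j. \<Sum>l\<in>UNIV. mat_pow G n i l * G l j)"

end

theory Submission
  imports Defs
begin

text \<open>
  Let \<open>f\<close> have mean zero and put \<open>D = \<parallel>f\<parallel>\<^sup>2 - \<parallel>P\<^sup>t f\<parallel>\<^sup>2\<close>; the claim is \<open>\<parallel>f\<parallel>\<^sup>2 \<le> C D\<close>
  for a constant \<open>C\<close>. As \<open>D\<close> is the sum over \<open>j < t\<close> of the mean variances of \<open>P\<^sup>j f\<close> under \<open>P(x, \<cdot>)\<close>,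
  and \<open>P\<close> dominates \<open>c P\<^sub>k\<close> on component \<open>k\<close>, each \<open>P\<^sup>j\<^sup>+\<^sup>1 f\<close> restricted to component \<open>k\<close> is within \<open>O(D)\<close>
  (in squared norm) of \<open>P\<^sub>k\<close> applied to the restriction of \<open>P\<^sup>j f\<close>. Hence \<open>P\<^sup>t f\<close> is close to \<open>P\<^sub>k\<^sup>t f\<close> on
  component \<open>k\<close>, and the gap of \<open>P\<^sub>k\<^sup>t\<close> forces \<open>f\<close> to be close to the function \<open>h\<close> of its component
  means. Then the transition energy of \<open>h\<close> between components is small, so by irreducibility of
  \<open>\<Gamma>\<close> the values of \<open>h\<close> are nearly equal, and as \<open>h\<close> has mean zero it is small too.

  Geometric convergence follows from the bound on \<open>P\<^sup>t\<close> by passing to the adjoint.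
\<close>

section \<open>Square-integrable functions\<close>

text \<open>From ||f||^2 <= C D follows ||P^t f||^2 <= (1 - 1/C) ||f||^2, the norm bound.
  \<open>P\<close> is not assumed reversible, so the norm loss takes the place of the quadratic form
  <f, f - P f>: by invariance, ||g||^2 - ||P g||^2 is the mean of the variances of g under P(x, .).
  Domination enters through Jensen's inequality: c (P g - P_k g)^2 is at most c times the P_k-mean
  of (g - P g(x))^2, hence at most that variance. The delicate point is that the gap of P_k^t
  contracts only f - h. The squared norm of P_k^t f is that of h plus at most r < 1 times that of f
  - h, and passing to P^t f multiplies this by 1 + \<theta>. The contribution of h has to cancel
  between the two sides, so \<theta> must be small, and a term \<eta> ||f||^2 is left over. The
  energy estimate bounds ||h||^2 by a multiple of ||f - h||^2 + D, through a constant A that depends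
  on the component weights and the transition masses only. Hence the order of choice: A, then \<eta>
  of order 1/A, and last the factor of D, which may grow as \<eta> shrinks.\<close>

lemma prob_algebra_cong_sets: "sets M = sets N \<Longrightarrow> prob_algebra M = prob_algebra N"
  unfolding prob_algebra_def by (simp cong: subprob_algebra_cong)

lemma L2_integrable:
  assumes "finite_measure M" "f \<in> L2 M" shows "integrable M f"
proof -
  interpret finite_measure M by fact
  show ?thesis using assms(2) unfolding L2_def by (simp add: square_integrable_imp_integrable)
qed

lemma L2_add: "f \<in> L2 M \<Longrightarrow> g \<in> L2 M \<Longrightarrow> (\<lambda>x. f x + g x) \<in> L2 M"
proof -
  assume "f \<in> L2 M" "g \<in> L2 M"
  hence [measurable]: "f \<in> borel_measurable M" "g \<in> borel_measurable M"
    and i: "integrable M (\<lambda>x. 2 * (f x)\<^sup>2 + 2 * (g x)\<^sup>2)" by (auto simp: L2_def)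
  have "(f x + g x)\<^sup>2 \<le> 2 * (f x)\<^sup>2 + 2 * (g x)\<^sup>2" for x
    using sum_squares_ge_zero[of "f x - g x" 0] by (simp add: power2_eq_square algebra_simps)
  hence "integrable M (\<lambda>x. (f x + g x)\<^sup>2)"
    by (intro Bochner_Integration.integrable_bound[OF i]) auto
  thus ?thesis by (simp add: L2_def)
qed

lemma L2_cmult: "f \<in> L2 M \<Longrightarrow> (\<lambda>x. c * f x) \<in> L2 M"
  by (auto simp: L2_def power_mult_distrib)

lemma L2_diff: "f \<in> L2 M \<Longrightarrow> g \<in> L2 M \<Longrightarrow> (\<lambda>x. f x - g x) \<in> L2 M"
  using L2_add[of f M "\<lambda>x. -1 * g x"] L2_cmult[of g M "-1"] by simp

lemma L2_mult_integrable:
  assumes "f \<in> L2 M" "g \<in> L2 M" shows "integrable M (\<lambda>x. f x * g x)"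
proof -
  have [measurable]: "f \<in> borel_measurable M" "g \<in> borel_measurable M"
    and i: "integrable M (\<lambda>x. (f x)\<^sup>2 + (g x)\<^sup>2)" using assms by (auto simp: L2_def)
  have "\<bar>f x * g x\<bar> \<le> (f x)\<^sup>2 + (g x)\<^sup>2" for x
  proof -
    have "2 * \<bar>f x * g x\<bar> \<le> (f x)\<^sup>2 + (g x)\<^sup>2"
      using sum_squares_bound[of "\<bar>f x\<bar>" "\<bar>g x\<bar>"] by (simp add: abs_mult)
    thus ?thesis by linarith
  qed
  thus ?thesis by (intro Bochner_Integration.integrable_bound[OF i]) auto
qed

lemma (in finite_measure) L2_const: "(\<lambda>x. c) \<in> L2 M"
  by (simp add: L2_def)

text \<open>Young's inequality with a free weight: the coefficient of \<open>f\<close> can be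
  brought as close to 1 as wanted, at the expense of \<open>g\<close>. The gap argument needs a
  small \<open>\<eta>\<close>; the comparison of iterates takes \<open>\<eta> = 1\<close>.\<close>

lemma L2_square_sum_le:
  assumes "f \<in> L2 M" "g \<in> L2 M" "0 < \<eta>"
  shows "(\<integral>x. (f x + g x)\<^sup>2 \<partial>M) \<le> (1 + \<eta>) * (\<integral>x. (f x)\<^sup>2 \<partial>M) + (1 + 1 / \<eta>) * (\<integral>x. (g x)\<^sup>2 \<partial>M)"
proof -
  have "(f x + g x)\<^sup>2 \<le> (1 + \<eta>) * (f x)\<^sup>2 + (1 + 1 / \<eta>) * (g x)\<^sup>2" for x
  proof -
    have "0 \<le> (\<eta> * f x - g x)\<^sup>2 / \<eta>" using assms by simp
    also have "\<dots> = \<eta> * (f x)\<^sup>2 + (g x)\<^sup>2 / \<eta> - 2 * f x * g x"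
      using assms by (simp add: power2_eq_square field_simps)
    finally show ?thesis by (simp add: power2_sum algebra_simps)
  qed
  hence "(\<integral>x. (f x + g x)\<^sup>2 \<partial>M) \<le> (\<integral>x. (1 + \<eta>) * (f x)\<^sup>2 + (1 + 1 / \<eta>) * (g x)\<^sup>2 \<partial>M)"
    using assms L2_add[of f M g] by (intro integral_mono) (auto simp: L2_def)
  also have "\<dots> = (1 + \<eta>) * (\<integral>x. (f x)\<^sup>2 \<partial>M) + (1 + 1 / \<eta>) * (\<integral>x. (g x)\<^sup>2 \<partial>M)"
    using assms by (simp add: L2_def)
  finally show ?thesis .
qed

lemma (in prob_space) integral_square_le:
  assumes "f \<in> L2 M"
  shows "(\<integral>x. f x \<partial>M)\<^sup>2 \<le> (\<integral>x. (f x)\<^sup>2 \<partial>M)"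
proof -
  have "variance f = (\<integral>x. (f x)\<^sup>2 \<partial>M) - (\<integral>x. f x \<partial>M)\<^sup>2"
    using assms L2_integrable[OF finite_measure_axioms assms] by (intro variance_eq) (auto simp: L2_def)
  thus ?thesis using variance_positive[of f] by linarith
qed

text \<open>\<open>RN_deriv\<close> may take the value infinity, which \<open>enn2real\<close> sends
  to 0. As \<open>mu\<close> is finite, this happens on a null set only, so the real density used in
  \<open>L2_star\<close> loses nothing.\<close>

lemma (in prob_space) nn_integral_density_real:
  assumes "mu \<in> space (prob_algebra M)" and ac: "absolutely_continuous M mu"
    and g: "g \<in> borel_measurable M"
  shows "(\<integral>\<^sup>+x. ennreal (g x) \<partial>mu) = (\<integral>\<^sup>+x. ennreal (enn2real (RN_deriv M mu x) * g x) \<partial>M)"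
proof -
  interpret mu: prob_space mu using assms by (simp add: space_prob_algebra)
  have s: "sets mu = sets M" using assms by (simp add: space_prob_algebra)
  have "AE x in M. RN_deriv M mu x \<noteq> \<infinity>"
    by (rule RN_deriv_finite[OF _ ac s]) (rule mu.sigma_finite_measure)
  moreover have "(\<integral>\<^sup>+x. ennreal (g x) \<partial>mu) = (\<integral>\<^sup>+x. RN_deriv M mu x * ennreal (g x) \<partial>M)"
    using g by (intro RN_deriv_nn_integral[OF ac s]) auto
  ultimately show ?thesis
    by (auto intro!: nn_integral_cong_AE elim!: eventually_mono simp: ennreal_mult' less_top)
qed

section \<open>Kernels with an invariant probability measure\<close>

locale invariant_kernel = prob_space M for M :: "'a measure" +
  fixes K :: "'a \<Rightarrow> 'a measure"
  assumes kernel [measurable]: "K \<in> M \<rightarrow>\<^sub>M prob_algebra M"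
    and invariant: "M \<bind> K = M"
begin

lemma kernel_subprob [measurable]: "K \<in> M \<rightarrow>\<^sub>M subprob_algebra M"
  using kernel by (rule measurable_prob_algebraD)

lemma prob_space_kernel: "x \<in> space M \<Longrightarrow> prob_space (K x)"
  using measurable_space[OF kernel] by (auto simp: space_prob_algebra)

lemma sets_kernel_eq: "x \<in> space M \<Longrightarrow> sets (K x) = sets M"
  using measurable_space[OF kernel] by (auto simp: space_prob_algebra)

lemma measurable_kernel_eq: "x \<in> space M \<Longrightarrow> borel_measurable (K x) = borel_measurable M"
  by (intro measurable_cong_sets sets_kernel_eq refl)

lemma nn_integral_kernel:
  assumes "f \<in> borel_measurable M"
  shows "(\<integral>\<^sup>+x. \<integral>\<^sup>+y. f y \<partial>K x \<partial>M) = (\<integral>\<^sup>+x. f x \<partial>M)"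
  using nn_integral_bind[OF assms kernel_subprob] by (simp add: invariant)

text \<open>Invariance makes an \<open>M\<close>-null set null for \<open>K x\<close> at almost
  every \<open>x\<close>. This is why functions may be changed on null sets although
  \<open>kernel_apply\<close> acts on representatives.\<close>

lemma AE_kernel:
  assumes [measurable]: "Measurable.pred M Q" and "AE x in M. Q x"
  shows "AE x in M. AE y in K x. Q y"
  using AE_bind[OF kernel_subprob assms(1)] assms(2) unfolding invariant by blast

lemma AE_kernel_cong:
  assumes "AE x in M. f x = g x" "f \<in> borel_measurable M" "g \<in> borel_measurable M"
  shows "AE x in M. kernel_apply K f x = kernel_apply K g x"
proof -
  have "AE x in M. AE y in K x. f y = (g y::real)"
    using assms by (intro AE_kernel) auto
  moreover have "AE x in M. x \<in> space M" by simp
  ultimately show ?thesis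
    by eventually_elim
      (use assms in \<open>auto simp: kernel_apply_def measurable_kernel_eq intro!: integral_cong_AE\<close>)
qed

lemma kernel_apply_measurable [measurable]:
  "f \<in> borel_measurable M \<Longrightarrow> kernel_apply K f \<in> borel_measurable M"
  unfolding kernel_apply_def
  using measurable_compose[OF kernel_subprob integral_measurable_subprob_algebra] .

text \<open>\<open>kernel_apply K f x\<close> is a genuine mean only where \<open>f\<close> is
  integrable under \<open>K x\<close>; elsewhere the integral has the default value 0. By invariance
  the iterated integral of the absolute value is finite, so the bad points form a null set.\<close>

lemma AE_kernel_integrable:
  fixes f :: "'a \<Rightarrow> real"
  assumes f: "integrable M f"
  shows "AE x in M. integrable (K x) f"
proof -
  have [measurable]: "f \<in> borel_measurable M" using f by simp
  have "(\<integral>\<^sup>+x. \<integral>\<^sup>+y. ennreal \<bar>f y\<bar> \<partial>K x \<partial>M) = (\<integral>\<^sup>+x. ennreal \<bar>f x\<bar> \<partial>M)"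
    by (rule nn_integral_kernel) simp
  also have "\<dots> < \<infinity>" using f by (simp add: integrable_iff_bounded)
  finally have "AE x in M. (\<integral>\<^sup>+y. ennreal \<bar>f y\<bar> \<partial>K x) \<noteq> \<infinity>"
    by (intro nn_integral_PInf_AE) auto
  moreover have "AE x in M. x \<in> space M" by simp
  ultimately show ?thesis
    by eventually_elim
      (auto simp: integrable_iff_bounded measurable_kernel_eq less_top)
qed

text \<open>Nonnegative functions come first, through \<open>nn_integral\<close>; real ones follow
  by splitting into positive and negative parts. \<open>kernel_apply_bind\<close> and
  \<open>integral_mixture\<close> use the same two stages.\<close>

lemma kernel_apply_nonneg_integral:
  fixes f :: "'a \<Rightarrow> real"
  assumes f: "integrable M f" and nn: "\<And>x. 0 \<le> f x"
  shows "integrable M (kernel_apply K f)" "(\<integral>x. kernel_apply K f x \<partial>M) = (\<integral>x. f x \<partial>M)"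
proof -
  have [measurable]: "f \<in> borel_measurable M" using f by simp
  have "(\<integral>\<^sup>+x. ennreal (kernel_apply K f x) \<partial>M) = (\<integral>\<^sup>+x. \<integral>\<^sup>+y. ennreal (f y) \<partial>K x \<partial>M)"
    using AE_kernel_integrable[OF f]
    by (intro nn_integral_cong_AE)
      (auto simp: kernel_apply_def nn nn_integral_eq_integral elim!: eventually_mono)
  also have "\<dots> = (\<integral>\<^sup>+x. ennreal (f x) \<partial>M)" by (rule nn_integral_kernel) simp
  also have "\<dots> = ennreal (\<integral>x. f x \<partial>M)" using f nn by (simp add: nn_integral_eq_integral)
  finally have *: "(\<integral>\<^sup>+x. ennreal (kernel_apply K f x) \<partial>M) = ennreal (\<integral>x. f x \<partial>M)" .
  have nn': "0 \<le> kernel_apply K f x" for x by (simp add: kernel_apply_def nn)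
  show 1: "integrable M (kernel_apply K f)"
    by (rule integrableI_nonneg) (auto simp: * nn')
  show "(\<integral>x. kernel_apply K f x \<partial>M) = (\<integral>x. f x \<partial>M)"
    using * nn_integral_eq_integral[OF 1] nn nn' by (simp add: integral_nonneg_AE)
qed

lemma kernel_apply_integral:
  fixes f :: "'a \<Rightarrow> real"
  assumes f: "integrable M f"
  shows "integrable M (kernel_apply K f)" "(\<integral>x. kernel_apply K f x \<partial>M) = (\<integral>x. f x \<partial>M)"
proof -
  have [measurable]: "f \<in> borel_measurable M" using f by simp
  define p n where "p = (\<lambda>x. max 0 (f x))" and "n = (\<lambda>x. max 0 (- f x))"
  have pn: "integrable M p" "integrable M n" "\<And>x. 0 \<le> p x" "\<And>x. 0 \<le> n x"
    using f by (auto simp: p_def n_def)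
  have f_eq: "f = (\<lambda>x. p x - n x)" by (auto simp: p_def n_def)
  have ae: "AE x in M. kernel_apply K f x = kernel_apply K p x - kernel_apply K n x"
    using AE_kernel_integrable[OF pn(1)] AE_kernel_integrable[OF pn(2)]
    by eventually_elim (simp add: kernel_apply_def f_eq)
  note i = kernel_apply_nonneg_integral[OF pn(1,3)] kernel_apply_nonneg_integral[OF pn(2,4)]
  have [measurable]: "p \<in> borel_measurable M" "n \<in> borel_measurable M" using pn by auto
  show "integrable M (kernel_apply K f)"
    using i by (subst integrable_cong_AE[OF _ _ ae]) auto
  show "(\<integral>x. kernel_apply K f x \<partial>M) = (\<integral>x. f x \<partial>M)"
    using i pn by (subst integral_cong_AE[OF _ _ ae]) (auto simp: f_eq)
qed

lemma kernel_square_le: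
  assumes "f \<in> L2 M"
  shows "AE x in M. (kernel_apply K f x)\<^sup>2 \<le> kernel_apply K (\<lambda>y. (f y)\<^sup>2) x"
proof -
  have f2: "integrable M (\<lambda>x. (f x)\<^sup>2)" using assms by (auto simp: L2_def)
  have "AE x in M. x \<in> space M" by simp
  with AE_kernel_integrable[OF L2_integrable[OF finite_measure_axioms assms]] AE_kernel_integrable[OF f2]
  show ?thesis
  proof eventually_elim
    case (elim x)
    interpret Kx: prob_space "K x" using elim by (intro prob_space_kernel)
    show ?case using Kx.variance_eq[of f] Kx.variance_positive[of f] elim by (simp add: kernel_apply_def)
  qed
qed

lemma kernel_apply_L2:
  assumes "f \<in> L2 M"
  shows "kernel_apply K f \<in> L2 M"
proof -
  have f2: "integrable M (\<lambda>x. (f x)\<^sup>2)" and [measurable]: "f \<in> borel_measurable M"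
    using assms by (auto simp: L2_def)
  have "integrable M (\<lambda>x. (kernel_apply K f x)\<^sup>2)"
    by (rule Bochner_Integration.integrable_bound[OF kernel_apply_integral(1)[OF f2]])
      (use kernel_square_le[OF assms] in \<open>auto elim!: eventually_mono\<close>)
  thus ?thesis by (simp add: L2_def)
qed

lemma kernel_apply_L2_0: "f \<in> L2_0 M \<Longrightarrow> kernel_apply K f \<in> L2_0 M"
  using kernel_apply_L2 kernel_apply_integral by (auto simp: L2_0_def)

text \<open>By invariance the image of \<open>(f y)\<^sup>2\<close> under \<open>K\<close> has the
  integral of \<open>(f y)\<^sup>2\<close> itself, so the mean variance under \<open>K x\<close> is
  exactly the loss of squared norm.\<close>

lemma kernel_variance_integral:
  assumes "f \<in> L2 M"
  shows "(\<integral>x. (kernel_apply K (\<lambda>y. (f y)\<^sup>2) x - (kernel_apply K f x)\<^sup>2) \<partial>M)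
    = (\<integral>x. (f x)\<^sup>2 \<partial>M) - (\<integral>x. (kernel_apply K f x)\<^sup>2 \<partial>M)"
    "integrable M (\<lambda>x. kernel_apply K (\<lambda>y. (f y)\<^sup>2) x - (kernel_apply K f x)\<^sup>2)"
  using assms kernel_apply_L2[OF assms] kernel_apply_integral[of "\<lambda>y. (f y)\<^sup>2"]
  by (auto simp: L2_def)

lemma kernel_apply_contraction:
  assumes "f \<in> L2 M"
  shows "(\<integral>x. (kernel_apply K f x)\<^sup>2 \<partial>M) \<le> (\<integral>x. (f x)\<^sup>2 \<partial>M)"
proof -
  have "0 \<le> (\<integral>x. (kernel_apply K (\<lambda>y. (f y)\<^sup>2) x - (kernel_apply K f x)\<^sup>2) \<partial>M)"
    using kernel_square_le[OF assms] by (intro integral_nonneg_AE) auto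
  thus ?thesis by (simp add: kernel_variance_integral assms)
qed

end

section \<open>Composition and powers of kernels\<close>

text \<open>Fubini's theorem for the composed kernel needs \<open>f\<close> to be integrable under
  \<open>K x \<bind> L\<close>. Invariance under both kernels gives this for almost every
  \<open>x\<close> only, hence the form of the conclusion.\<close>

lemma kernel_apply_bind:
  assumes "invariant_kernel M K" "invariant_kernel M L" "integrable M f"
  shows "AE x in M. kernel_apply (\<lambda>x. K x \<bind> L) f x = kernel_apply K (kernel_apply L f) x"
proof -
  interpret K: invariant_kernel M K by fact
  interpret L: invariant_kernel M L by fact
  have [measurable]: "f \<in> borel_measurable M" using assms by simp
  define p n where "p = (\<lambda>x. max 0 (f x))" and "n = (\<lambda>x. max 0 (- f x))"
  have pn: "integrable M p" "integrable M n" "\<And>x. 0 \<le> p x" "\<And>x. 0 \<le> n x"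
    using assms by (auto simp: p_def n_def)
  have [measurable]: "p \<in> borel_measurable M" "n \<in> borel_measurable M" using pn by auto
  have f_eq: "f = (\<lambda>x. p x - n x)" by (auto simp: p_def n_def)
  have nonneg: "AE x in M. integrable (K x \<bind> L) q \<and>
      (\<integral>y. q y \<partial>(K x \<bind> L)) = kernel_apply K (kernel_apply L q) x"
    if q: "integrable M q" "\<And>x. 0 \<le> (q x :: real)" for q
  proof -
    have [measurable]: "q \<in> borel_measurable M" using q by auto
    have ae: "AE x in M. AE y in K x. integrable (L y) q"
      using L.AE_kernel_integrable[OF q(1)]
      by (intro K.AE_kernel) measurable
    have "AE x in M. x \<in> space M" by simp
    with ae K.AE_kernel_integrable[OF L.kernel_apply_integral(1)[OF q(1)]]
    show ?thesis
    proof eventually_elim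
      case (elim x)
      have m: "L \<in> K x \<rightarrow>\<^sub>M subprob_algebra M"
        using L.kernel_subprob elim by (simp cong: measurable_cong_sets add: K.sets_kernel_eq)
      have nn': "0 \<le> kernel_apply L q x" for x by (simp add: kernel_apply_def q)
      have "space (K x) \<noteq> {}"
        using prob_space.not_empty[OF K.prob_space_kernel] elim by auto
      then have s: "sets (K x \<bind> L) = sets M"
        using m by (intro sets_bind[where N=M]) (auto simp: sets_kernel)
      have "(\<integral>\<^sup>+y. ennreal (q y) \<partial>(K x \<bind> L)) = (\<integral>\<^sup>+y. \<integral>\<^sup>+z. ennreal (q z) \<partial>L y \<partial>K x)"
        by (rule nn_integral_bind[OF _ m]) simp
      also have "\<dots> = (\<integral>\<^sup>+y. ennreal (kernel_apply L q y) \<partial>K x)"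
        using elim(1) by (intro nn_integral_cong_AE)
          (auto simp: kernel_apply_def q nn_integral_eq_integral elim!: eventually_mono)
      also have "\<dots> = ennreal (kernel_apply K (kernel_apply L q) x)"
        using elim nn' by (subst nn_integral_eq_integral) (auto simp: kernel_apply_def[of K])
      finally have *: "(\<integral>\<^sup>+y. ennreal (q y) \<partial>(K x \<bind> L)) = ennreal (kernel_apply K (kernel_apply L q) x)" .
      have b: "q \<in> borel_measurable (K x \<bind> L)" using s by (simp cong: measurable_cong_sets)
      have i: "integrable (K x \<bind> L) q"
        by (rule integrableI_nonneg) (use b q * in auto)
      have "0 \<le> kernel_apply K (kernel_apply L q) x" by (simp add: kernel_apply_def q)
      with * i q show ?case by (auto simp: nn_integral_eq_integral integral_nonneg_AE)
    qed
  qed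
  \<comment> \<open>The linearity of \<open>L\<close> on \<open>f = p - n\<close> fails on a null
    set of points \<open>y\<close>; for almost every \<open>x\<close> this set is invisible to
    \<open>K x\<close>.\<close>
  have "AE x in M. AE y in K x. kernel_apply L f y = kernel_apply L p y - kernel_apply L n y"
  proof (rule K.AE_kernel)
    have [measurable]: "kernel_apply L f \<in> borel_measurable M" "kernel_apply L p \<in> borel_measurable M"
      "kernel_apply L n \<in> borel_measurable M" by (simp_all add: L.kernel_apply_measurable)
    show "Measurable.pred M (\<lambda>x. kernel_apply L f x = kernel_apply L p x - kernel_apply L n x)"
      by measurable
    show "AE x in M. kernel_apply L f x = kernel_apply L p x - kernel_apply L n x"
      using L.AE_kernel_integrable[OF pn(1)] L.AE_kernel_integrable[OF pn(2)]
      by eventually_elim (simp add: kernel_apply_def f_eq)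
  qed
  moreover have "AE x in M. x \<in> space M" by simp
  ultimately show ?thesis
    using nonneg[OF pn(1,3)] nonneg[OF pn(2,4)]
      K.AE_kernel_integrable[OF L.kernel_apply_integral(1)[OF pn(1)]]
      K.AE_kernel_integrable[OF L.kernel_apply_integral(1)[OF pn(2)]]
  proof eventually_elim
    case (elim x)
    have [measurable_cong]: "sets (K x) = sets M" using elim K.sets_kernel_eq by auto
    have "kernel_apply K (kernel_apply L f) x = (\<integral>y. kernel_apply L p y - kernel_apply L n y \<partial>K x)"
      unfolding kernel_apply_def[of K] using elim by (intro integral_cong_AE) (auto simp: K.measurable_kernel_eq intro!: borel_measurable_diff L.kernel_apply_measurable)
    thus ?case using elim by (simp add: kernel_apply_def f_eq)
  qed
qed

text \<open>The measure enters \<open>kernel_pow\<close> only through \<open>return\<close>, hence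
  only through its sigma-algebra. This reconciles powers formed over \<open>Psi k\<close> or
  \<open>union_space Psi\<close> in the theorem with powers formed over the probability
  measures.\<close>

lemma kernel_pow_cong_sets:
  assumes "sets M = sets N" shows "kernel_pow M K n = kernel_pow N K n"
  by (induction n) (auto simp: return_sets_cong[OF assms])

context invariant_kernel
begin

lemma invariant_kernel_pow: "invariant_kernel M (kernel_pow M K n)"
proof (induction n)
  case 0
  show ?case
    by standard (auto simp: bind_return'' intro!: measurable_prob_algebraI prob_space_return)
next
  case (Suc n)
  interpret n: invariant_kernel M "kernel_pow M K n" by fact
  show ?case
  proof
    show "kernel_pow M K (Suc n) \<in> M \<rightarrow>\<^sub>M prob_algebra M"
      unfolding kernel_pow.simps using kernel n.kernel by (rule measurable_bind_prob_space)
    show "M \<bind> kernel_pow M K (Suc n) = M"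
      unfolding kernel_pow.simps
      by (subst bind_assoc[symmetric, OF kernel_subprob n.kernel_subprob]) (simp add: invariant n.invariant)
  qed
qed

lemma kernel_pow_apply_0: "f \<in> borel_measurable M \<Longrightarrow> x \<in> space M \<Longrightarrow> kernel_apply (kernel_pow M K 0) f x = f x"
  by (simp add: kernel_apply_def integral_return)

lemma kernel_pow_apply_Suc:
  assumes "integrable M f"
  shows "AE x in M. kernel_apply (kernel_pow M K (Suc n)) f x = kernel_apply K (kernel_apply (kernel_pow M K n) f) x"
  using kernel_apply_bind[OF invariant_kernel_axioms invariant_kernel_pow assms] by simp

lemma kernel_pow_measurable: "f \<in> borel_measurable M \<Longrightarrow> kernel_apply (kernel_pow M K n) f \<in> borel_measurable M"
  by (rule invariant_kernel.kernel_apply_measurable[OF invariant_kernel_pow])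

lemma kernel_pow_apply_add:
  assumes f: "integrable M f"
  shows "AE x in M. kernel_apply (kernel_pow M K (m + n)) f x
    = kernel_apply (kernel_pow M K m) (kernel_apply (kernel_pow M K n) f) x"
proof (induction m)
  case 0
  show ?case
    using kernel_pow_apply_0[OF kernel_pow_measurable] f by (intro AE_I2) (auto simp del: kernel_pow.simps)
next
  case (Suc m)
  note [simp del] = kernel_pow.simps
  have i: "integrable M (kernel_apply (kernel_pow M K n) f)"
    by (rule invariant_kernel.kernel_apply_integral[OF invariant_kernel_pow f])
  show ?case
    using kernel_pow_apply_Suc[OF f, of "m + n"] kernel_pow_apply_Suc[OF i, of m]
      AE_kernel_cong[OF Suc] kernel_pow_measurable f i
    by (auto elim!: eventually_elim2 simp: kernel_pow_measurable)
qed

end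

section \<open>Geometric convergence from the operator norm\<close>

text \<open>The bound is extracted for squared norms, with \<open>r\<close> the square of a number
  strictly between \<open>op_norm M K\<close> and 1. Functions of norm zero lie outside the supremum
  and are handled by contraction.\<close>

lemma op_norm_less_1D:
  assumes "invariant_kernel M K" "op_norm M K < 1"
  obtains r where "0 < r" "r < 1"
    "\<And>g. g \<in> L2_0 M \<Longrightarrow> (\<integral>x. (kernel_apply K g x)\<^sup>2 \<partial>M) \<le> r * (\<integral>x. (g x)\<^sup>2 \<partial>M)"
proof -
  interpret invariant_kernel M K by fact
  \<comment> \<open>The supremum is \<open>-\<infinity>\<close> if no function in
    \<open>L2_0 M\<close> has nonzero norm; the maximum with 0 yields a positive \<open>q\<close> in
    that case as well.\<close>
  have "max 0 (op_norm M K) < 1" using assms by simp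
  then obtain e where e: "max 0 (op_norm M K) < e" "e < 1" using ereal_dense2 by blast
  then obtain q where q: "e = ereal q" by (cases e) auto
  have q01: "0 < q" "q < 1" using e q by (auto simp: one_ereal_def)
  show ?thesis
  proof (rule that[of "q\<^sup>2"])
    show "0 < q\<^sup>2" "q\<^sup>2 < 1" using q01 by (auto simp: power_less_one_iff)
    fix g assume g: "g \<in> L2_0 M"
    show "(\<integral>x. (kernel_apply K g x)\<^sup>2 \<partial>M) \<le> q\<^sup>2 * (\<integral>x. (g x)\<^sup>2 \<partial>M)"
    proof (cases "L2_norm M g = 0")
      case True
      hence "(\<integral>x. (g x)\<^sup>2 \<partial>M) = 0" by (simp add: L2_norm_def)
      with kernel_apply_contraction[of g] g show ?thesis by (simp add: L2_0_def)
    next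
      case False
      hence "ereal (L2_norm M (kernel_apply K g) / L2_norm M g) \<le> op_norm M K"
        unfolding op_norm_def using g by (intro SUP_upper) auto
      also have "\<dots> < ereal q" using e q by simp
      finally have "L2_norm M (kernel_apply K g) / L2_norm M g \<le> q" by simp
      moreover have "L2_norm M g > 0" using False by (simp add: L2_norm_def less_le)
      ultimately have "L2_norm M (kernel_apply K g) \<le> q * L2_norm M g" by (simp add: field_simps)
      hence "(L2_norm M (kernel_apply K g))\<^sup>2 \<le> (q * L2_norm M g)\<^sup>2"
        by (intro power_mono) (simp_all add: L2_norm_def)
      thus ?thesis by (simp add: L2_norm_def power_mult_distrib)
    qed
  qed
qed

lemma op_norm_less_1I:
  assumes "r < 1"
    and "\<And>g. g \<in> L2_0 M \<Longrightarrow> (\<integral>x. (kernel_apply K g x)\<^sup>2 \<partial>M) \<le> r * (\<integral>x. (g x)\<^sup>2 \<partial>M)"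
  shows "op_norm M K < 1"
proof -
  have "op_norm M K \<le> ereal (sqrt r)"
    unfolding op_norm_def
  proof (rule SUP_least)
    fix g assume "g \<in> {f \<in> L2_0 M. L2_norm M f \<noteq> 0}"
    hence g: "g \<in> L2_0 M" and "L2_norm M g \<noteq> 0" by auto
    hence "L2_norm M g > 0" by (simp add: L2_norm_def less_le)
    moreover have "L2_norm M (kernel_apply K g) \<le> sqrt r * L2_norm M g"
      unfolding L2_norm_def real_sqrt_mult[symmetric] using assms(2)[OF g] by (rule real_sqrt_le_mono)
    ultimately show "ereal (L2_norm M (kernel_apply K g) / L2_norm M g) \<le> ereal (sqrt r)"
      by (simp add: field_simps)
  qed
  also have "\<dots> < 1" using assms(1) by (simp add: one_ereal_def)
  finally show ?thesis .
qed

section \<open>Densities of \<open>mu \<bind> K\<close>\<close>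

context invariant_kernel
begin

lemma absolutely_continuous_bind:
  assumes mu: "mu \<in> space (prob_algebra M)" and ac: "absolutely_continuous M mu"
  shows "mu \<bind> K \<in> space (prob_algebra M)" "absolutely_continuous M (mu \<bind> K)"
proof -
  interpret mu: prob_space mu using mu by (simp add: space_prob_algebra)
  have s: "sets mu = sets M" using mu by (simp add: space_prob_algebra)
  have Kmu: "K \<in> mu \<rightarrow>\<^sub>M prob_algebra M" using kernel by (simp cong: measurable_cong_sets add: s)
  show "mu \<bind> K \<in> space (prob_algebra M)"
    using mu.prob_space_axioms Kmu mu
    by (auto simp: space_prob_algebra s intro!: prob_space_bind'[where N=M] sets_bind'[where N=M])
  show "absolutely_continuous M (mu \<bind> K)"
    unfolding absolutely_continuous_def
  proof
    fix A assume A: "A \<in> null_sets M"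
    hence [measurable]: "A \<in> sets M" and "AE x in M. x \<notin> A" by (auto simp: AE_not_in)
    hence "AE x in M. AE y in K x. y \<notin> A" by (intro AE_kernel) auto
    hence "AE x in mu. AE y in K x. y \<notin> A" by (rule absolutely_continuous_AE[OF s ac])
    hence "AE y in mu \<bind> K. y \<notin> A"
      by (subst AE_bind[where B=M]) (auto intro!: measurable_prob_algebraD[OF Kmu])
    moreover have "A \<in> sets (mu \<bind> K)"
      using Kmu mu by (subst sets_bind'[where N=M]) (auto simp: s space_prob_algebra)
    ultimately show "A \<in> null_sets (mu \<bind> K)" by (simp add: AE_iff_null_sets)
  qed
qed

text \<open>The adjoint relation <v, g> = <u, K g> for the densities u of \<open>mu\<close> and v of
  \<open>mu \<bind> K\<close>. It is stated with \<open>nn_integral\<close> since v is not yet known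
  to be square integrable.\<close>

lemma nn_integral_bind_density:
  assumes mu: "mu \<in> space (prob_algebra M)" and ac: "absolutely_continuous M mu"
    and g: "integrable M g" "\<And>x. 0 \<le> g x"
  shows "(\<integral>\<^sup>+x. ennreal (enn2real (RN_deriv M (mu \<bind> K) x) * g x) \<partial>M)
    = (\<integral>\<^sup>+x. ennreal (enn2real (RN_deriv M mu x) * kernel_apply K g x) \<partial>M)"
proof -
  have [measurable]: "g \<in> borel_measurable M" using g by auto
  have s: "sets mu = sets M" using mu by (simp add: space_prob_algebra)
  have Kmu: "K \<in> mu \<rightarrow>\<^sub>M subprob_algebra M" using kernel_subprob by (simp cong: measurable_cong_sets add: s)
  have "(\<integral>\<^sup>+x. ennreal (enn2real (RN_deriv M (mu \<bind> K) x) * g x) \<partial>M) = (\<integral>\<^sup>+x. ennreal (g x) \<partial>(mu \<bind> K))"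
    by (rule nn_integral_density_real[symmetric]) (auto simp: absolutely_continuous_bind[OF mu ac])
  also have "\<dots> = (\<integral>\<^sup>+x. \<integral>\<^sup>+y. ennreal (g y) \<partial>K x \<partial>mu)"
    by (rule nn_integral_bind[OF _ Kmu]) simp
  also have "\<dots> = (\<integral>\<^sup>+x. ennreal (kernel_apply K g x) \<partial>mu)"
    using absolutely_continuous_AE[OF s ac AE_kernel_integrable[OF g(1)]]
    by (intro nn_integral_cong_AE)
      (auto simp: kernel_apply_def g nn_integral_eq_integral elim!: eventually_mono)
  also have "\<dots> = (\<integral>\<^sup>+x. ennreal (enn2real (RN_deriv M mu x) * kernel_apply K g x) \<partial>M)"
    by (rule nn_integral_density_real[OF mu ac]) simp
  finally show ?thesis .
qed

text \<open>Testing the adjoint relation against v itself would give ||v|| <= ||u||, but presupposes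
  that ||v|| is finite. It is tested against the truncations \<open>g n\<close> instead; the bound
  does not depend on \<open>n\<close>, and monotone convergence passes to v.\<close>

lemma L2_star_bind:
  assumes "mu \<in> L2_star M"
  shows "mu \<bind> K \<in> L2_star M"
proof -
  define u v where "u = (\<lambda>x. enn2real (RN_deriv M mu x))"
    and "v = (\<lambda>x. enn2real (RN_deriv M (mu \<bind> K) x))"
  have mu: "mu \<in> space (prob_algebra M)" and ac: "absolutely_continuous M mu" and u: "u \<in> L2 M"
    using assms by (auto simp: L2_star_def u_def)
  have [measurable]: "u \<in> borel_measurable M" "v \<in> borel_measurable M" by (auto simp: u_def v_def)
  have uv: "0 \<le> u x" "0 \<le> v x" for x by (auto simp: u_def v_def)
  define g where "g n x = min (v x) (real n)" for n x
  have [measurable]: "g n \<in> borel_measurable M" for n by (simp add: g_def[abs_def])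
  have g: "0 \<le> g n x" "g n x \<le> v x" "g n x \<le> n" for n x by (auto simp: g_def uv)
  have gL2: "g n \<in> L2 M" for n
    unfolding L2_def by (auto intro!: integrable_const_bound[where B="(real n)\<^sup>2"] power_mono simp: g)
  have bound: "(\<integral>\<^sup>+x. ennreal ((g n x)\<^sup>2) \<partial>M) \<le> ennreal (\<integral>x. (u x)\<^sup>2 \<partial>M)" for n
  proof -
    define a where "a = kernel_apply K (g n)"
    have a: "a \<in> L2 M" unfolding a_def by (rule kernel_apply_L2[OF gL2])
    have i: "integrable M (\<lambda>x. (u x)\<^sup>2)" "integrable M (\<lambda>x. (a x)\<^sup>2)" "integrable M (\<lambda>x. (g n x)\<^sup>2)"
      using u a gL2 by (auto simp: L2_def)
    have "ennreal (\<integral>x. (g n x)\<^sup>2 \<partial>M) = (\<integral>\<^sup>+x. ennreal ((g n x)\<^sup>2) \<partial>M)"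
      using i by (simp add: nn_integral_eq_integral)
    also have "\<dots> \<le> (\<integral>\<^sup>+x. ennreal (v x * g n x) \<partial>M)"
      by (intro nn_integral_mono ennreal_leI) (auto simp: power2_eq_square g intro!: mult_right_mono)
    also have "\<dots> = (\<integral>\<^sup>+x. ennreal (u x * a x) \<partial>M)"
      unfolding u_def v_def a_def
      by (rule nn_integral_bind_density[OF mu ac L2_integrable[OF finite_measure_axioms gL2] g(1)])
    also have "\<dots> \<le> (\<integral>\<^sup>+x. ennreal (((u x)\<^sup>2 + (a x)\<^sup>2) / 2) \<partial>M)"
    proof (intro nn_integral_mono ennreal_leI)
      fix x show "u x * a x \<le> ((u x)\<^sup>2 + (a x)\<^sup>2) / 2"
        using sum_squares_bound[of "u x" "a x"] by simp
    qed
    also have "\<dots> = ennreal (((\<integral>x. (u x)\<^sup>2 \<partial>M) + (\<integral>x. (a x)\<^sup>2 \<partial>M)) / 2)"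
      using i by (subst nn_integral_eq_integral) auto
    finally have "(\<integral>x. (g n x)\<^sup>2 \<partial>M) \<le> ((\<integral>x. (u x)\<^sup>2 \<partial>M) + (\<integral>x. (a x)\<^sup>2 \<partial>M)) / 2"
      by (subst (asm) ennreal_le_iff) auto
    also have "\<dots> \<le> ((\<integral>x. (u x)\<^sup>2 \<partial>M) + (\<integral>x. (g n x)\<^sup>2 \<partial>M)) / 2"
      unfolding a_def using kernel_apply_contraction[OF gL2] by simp
    \<comment> \<open>The squared norm of \<open>g n\<close> stands on both sides; being finite
      thanks to the truncation, half of it can be subtracted.\<close>
    finally show ?thesis using i by (simp add: nn_integral_eq_integral)
  qed
  have "(\<lambda>n. \<integral>\<^sup>+x. ennreal ((g n x)\<^sup>2) \<partial>M) \<longlonglongrightarrow> (\<integral>\<^sup>+x. ennreal ((v x)\<^sup>2) \<partial>M)"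
  proof (rule nn_integral_LIMSEQ)
    show "incseq (\<lambda>n x. ennreal ((g n x)\<^sup>2))"
      by (auto simp: incseq_def le_fun_def uv g_def intro!: ennreal_leI power_mono)
    show "(\<lambda>n. ennreal ((g n x)\<^sup>2)) \<longlonglongrightarrow> ennreal ((v x)\<^sup>2)" for x
    proof (rule tendsto_eventually)
      obtain N where "v x \<le> real N" using real_arch_simple by blast
      thus "\<forall>\<^sub>F n in sequentially. ennreal ((g n x)\<^sup>2) = ennreal ((v x)\<^sup>2)"
        unfolding eventually_sequentially by (intro exI[of _ N]) (auto simp: g_def min_absorb1)
    qed
  qed simp
  hence "(\<integral>\<^sup>+x. ennreal ((v x)\<^sup>2) \<partial>M) \<le> ennreal (\<integral>x. (u x)\<^sup>2 \<partial>M)"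
    using bound by (intro LIMSEQ_le_const2) auto
  hence "integrable M (\<lambda>x. (v x)\<^sup>2)"
    by (intro integrableI_nonneg) (auto intro: le_less_trans)
  hence "v \<in> L2 M" by (simp add: L2_def)
  thus ?thesis
    using absolutely_continuous_bind[OF mu ac] by (simp add: L2_star_def v_def)
qed

end

lemma (in prob_space) L2_star_density_integral:
  assumes "mu \<in> L2_star M"
  shows "(\<integral>x. enn2real (RN_deriv M mu x) \<partial>M) = 1"
proof -
  have mu: "mu \<in> space (prob_algebra M)" and ac: "absolutely_continuous M mu"
    and u: "(\<lambda>x. enn2real (RN_deriv M mu x)) \<in> L2 M"
    using assms by (auto simp: L2_star_def)
  interpret mu: prob_space mu using mu by (simp add: space_prob_algebra)
  have "(\<integral>\<^sup>+x. ennreal (enn2real (RN_deriv M mu x)) \<partial>M) = (\<integral>\<^sup>+x. ennreal 1 \<partial>mu)"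
    using nn_integral_density_real[OF mu ac, of "\<lambda>_. 1"] by simp
  also have "\<dots> = 1" by (simp add: mu.emeasure_space_1)
  finally have "ennreal (\<integral>x. enn2real (RN_deriv M mu x) \<partial>M) = 1"
    using L2_integrable[OF finite_measure_axioms u] by (simp add: nn_integral_eq_integral)
  thus ?thesis by simp
qed

lemma (in prob_space) L2_dist_stationary:
  "(L2_dist M mu M)\<^sup>2 = (\<integral>x. (enn2real (RN_deriv M mu x) - 1)\<^sup>2 \<partial>M)"
proof -
  have "AE x in M. 1 = RN_deriv M M x"
    by (rule RN_deriv_unique) (auto simp: density_1)
  hence "(\<integral>x. (enn2real (RN_deriv M mu x) - enn2real (RN_deriv M M x))\<^sup>2 \<partial>M)
      = (\<integral>x. (enn2real (RN_deriv M mu x) - 1)\<^sup>2 \<partial>M)"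
    by (intro integral_cong_AE) (auto elim!: eventually_mono)
  thus ?thesis by (simp add: L2_dist_def L2_norm_def)
qed

text \<open>Passing to the adjoint: with \<open>u\<close> and \<open>v\<close> the densities of \<open>mu\<close> and \<open>mu \<bind> K\<close>, one has
  \<open>\<parallel>v - 1\<parallel>\<^sup>2 = \<langle>u - 1, K (v - 1)\<rangle>\<close>.\<close>

lemma (in invariant_kernel) L2_dist_bind_le:
  assumes mu: "mu \<in> L2_star M" and r: "0 < r"
    and K: "\<And>g. g \<in> L2_0 M \<Longrightarrow> (\<integral>x. (kernel_apply K g x)\<^sup>2 \<partial>M) \<le> r * (\<integral>x. (g x)\<^sup>2 \<partial>M)"
  shows "(L2_dist M (mu \<bind> K) M)\<^sup>2 \<le> r * (L2_dist M mu M)\<^sup>2"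
proof -
  define u v where "u = (\<lambda>x. enn2real (RN_deriv M mu x))"
    and "v = (\<lambda>x. enn2real (RN_deriv M (mu \<bind> K) x))"
  \<comment> \<open>To be used with \<open>W\<close> = ||v - 1||^2, \<open>X\<close> = r ||u - 1||^2
    and \<open>Y\<close> = ||K (v - 1)||^2 / r.\<close>
  have average: "W \<le> (X + Y) / 2 \<Longrightarrow> Y \<le> W \<Longrightarrow> W \<le> X" for W X Y :: real by simp
  have muK: "mu \<bind> K \<in> L2_star M" by (rule L2_star_bind[OF mu])
  have u: "u \<in> L2 M" and v: "v \<in> L2 M" using mu muK by (auto simp: L2_star_def u_def v_def)
  have nn: "0 \<le> u x" "0 \<le> v x" for x by (auto simp: u_def v_def)
  define a where "a = kernel_apply K v"
  have a: "a \<in> L2 M" unfolding a_def by (rule kernel_apply_L2[OF v])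
  note integrable = L2_integrable[OF finite_measure_axioms]
  have int1: "(\<integral>x. u x \<partial>M) = 1" "(\<integral>x. v x \<partial>M) = 1" "(\<integral>x. a x \<partial>M) = 1"
    unfolding a_def kernel_apply_integral(2)[OF integrable[OF v]]
    unfolding u_def v_def using mu muK by (simp_all add: L2_star_density_integral)
  define w where "w = (\<lambda>x. v x - 1)"
  have w: "w \<in> L2 M" unfolding w_def using v L2_const by (rule L2_diff)
  hence w0: "w \<in> L2_0 M" using integrable[OF v] integrable[OF w] int1 by (simp add: L2_0_def w_def prob_space)
  have "(\<integral>\<^sup>+x. ennreal (v x * v x) \<partial>M) = (\<integral>\<^sup>+x. ennreal (u x * a x) \<partial>M)"
    unfolding u_def a_def v_def
    by (rule nn_integral_bind_density) (use mu integrable[OF v] in \<open>auto simp: L2_star_def v_def\<close>)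
  moreover have "0 \<le> a x" for x by (simp add: a_def kernel_apply_def nn)
  ultimately have dual: "(\<integral>x. v x * v x \<partial>M) = (\<integral>x. u x * a x \<partial>M)"
    using L2_mult_integrable[OF v v] L2_mult_integrable[OF u a] nn
    by (simp add: nn_integral_eq_integral integral_nonneg_AE)
  have ae: "AE x in M. kernel_apply K w x = a x - 1"
    using AE_kernel_integrable[OF integrable[OF v]] AE_space
    by eventually_elim
      (simp add: kernel_apply_def w_def a_def prob_space.prob_space prob_space_kernel
        finite_measure.integrable_const prob_space.finite_measure)
  have Kw: "(\<integral>x. (kernel_apply K w x)\<^sup>2 \<partial>M) = (\<integral>x. (a x - 1)\<^sup>2 \<partial>M)"
    using ae w a by (intro integral_cong_AE) (auto simp: L2_def elim!: eventually_mono)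
  have i: "integrable M u" "integrable M v" "integrable M a" "integrable M (\<lambda>x. u x * a x)"
     "integrable M (\<lambda>x. v x * v x)"
    using integrable u v a L2_mult_integrable by auto
  have L2': "(\<lambda>x. u x - 1) \<in> L2 M" "(\<lambda>x. a x - 1) \<in> L2 M" using u a L2_const by (auto intro: L2_diff)
  \<comment> \<open>As \<open>u\<close>, \<open>v\<close> and \<open>a\<close> all have integral 1,
    the relation \<open>dual\<close> carries over to the centred functions.\<close>
  have "(\<integral>x. (w x)\<^sup>2 \<partial>M) = (\<integral>x. v x * v x - 2 * v x + 1 \<partial>M)"
    by (simp add: w_def power2_eq_square algebra_simps)
  also have "\<dots> = (\<integral>x. u x * a x \<partial>M) - 1"
    using i int1 by (simp add: dual prob_space)
  also have "\<dots> = (\<integral>x. u x * a x - u x - a x + 1 \<partial>M)"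
    using i int1 by (simp add: prob_space)
  also have "\<dots> = (\<integral>x. (u x - 1) * (a x - 1) \<partial>M)" by (simp add: algebra_simps)
  \<comment> \<open>The weight \<open>r\<close> is matched to the assumed bound on \<open>K\<close>,
    which makes the second term at most ||w||^2 and lets it be absorbed.\<close>
  also have "\<dots> \<le> (\<integral>x. (r * (u x - 1)\<^sup>2 + (a x - 1)\<^sup>2 / r) / 2 \<partial>M)"
  proof (rule integral_mono)
    show "integrable M (\<lambda>x. (u x - 1) * (a x - 1))" by (rule L2_mult_integrable[OF L2'])
    show "integrable M (\<lambda>x. (r * (u x - 1)\<^sup>2 + (a x - 1)\<^sup>2 / r) / 2)" using L2' by (auto simp: L2_def)
    fix x
    have "0 \<le> (r * (u x - 1) - (a x - 1))\<^sup>2" by simp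
    also have "\<dots> = r * (r * (u x - 1)\<^sup>2 + (a x - 1)\<^sup>2 / r - 2 * ((u x - 1) * (a x - 1)))"
      using r by (simp add: power2_eq_square field_simps)
    finally show "(u x - 1) * (a x - 1) \<le> (r * (u x - 1)\<^sup>2 + (a x - 1)\<^sup>2 / r) / 2"
      using r by (simp add: zero_le_mult_iff)
  qed
  also have "\<dots> = (r * (\<integral>x. (u x - 1)\<^sup>2 \<partial>M) + (\<integral>x. (a x - 1)\<^sup>2 \<partial>M) / r) / 2"
    using L2' by (simp add: L2_def)
  finally have "(\<integral>x. (w x)\<^sup>2 \<partial>M) \<le> (r * (\<integral>x. (u x - 1)\<^sup>2 \<partial>M) + (\<integral>x. (a x - 1)\<^sup>2 \<partial>M) / r) / 2" .
  moreover have "(\<integral>x. (a x - 1)\<^sup>2 \<partial>M) / r \<le> (\<integral>x. (w x)\<^sup>2 \<partial>M)"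
    using K[OF w0] r by (simp add: Kw field_simps)
  ultimately have "(\<integral>x. (w x)\<^sup>2 \<partial>M) \<le> r * (\<integral>x. (u x - 1)\<^sup>2 \<partial>M)"
    by (rule average)
  thus ?thesis by (simp add: L2_dist_stationary u_def v_def w_def)
qed

section \<open>Geometric rate from a contraction after \<open>t\<close> steps\<close>

text \<open>Each of the \<open>q\<close> blocks of \<open>t\<close> steps gains a factor
  \<open>r\<close>, and the \<open>m\<close> leftover steps do not increase the norm.\<close>

lemma (in invariant_kernel) kernel_pow_block_bound:
  assumes r: "0 \<le> r"
    and K: "\<And>g. g \<in> L2_0 M \<Longrightarrow> (\<integral>x. (kernel_apply (kernel_pow M K t) g x)\<^sup>2 \<partial>M) \<le> r * (\<integral>x. (g x)\<^sup>2 \<partial>M)"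
    and g: "g \<in> L2_0 M"
  shows "(\<integral>x. (kernel_apply (kernel_pow M K (q * t + m)) g x)\<^sup>2 \<partial>M) \<le> r ^ q * (\<integral>x. (g x)\<^sup>2 \<partial>M)"
proof (induction q)
  case 0
  show ?case
    using invariant_kernel.kernel_apply_contraction[OF invariant_kernel_pow, of g] g by (simp add: L2_0_def)
next
  case (Suc q)
  define h where "h = kernel_apply (kernel_pow M K (q * t + m)) g"
  have h: "h \<in> L2_0 M"
    unfolding h_def by (rule invariant_kernel.kernel_apply_L2_0[OF invariant_kernel_pow g])
  have [measurable]: "g \<in> borel_measurable M" "h \<in> borel_measurable M" using g h by (auto simp: L2_0_def L2_def)
  have "AE x in M. kernel_apply (kernel_pow M K (Suc q * t + m)) g x = kernel_apply (kernel_pow M K t) h x"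
    using kernel_pow_apply_add[of g t "q * t + m"] g by (simp add: L2_0_def h_def algebra_simps)
  hence "(\<integral>x. (kernel_apply (kernel_pow M K (Suc q * t + m)) g x)\<^sup>2 \<partial>M)
      = (\<integral>x. (kernel_apply (kernel_pow M K t) h x)\<^sup>2 \<partial>M)"
    by (intro integral_cong_AE borel_measurable_power kernel_pow_measurable) (auto elim!: eventually_mono)
  also have "\<dots> \<le> r * (\<integral>x. (h x)\<^sup>2 \<partial>M)" by (rule K[OF h])
  also have "\<dots> \<le> r * (r ^ q * (\<integral>x. (g x)\<^sup>2 \<partial>M))"
    using Suc r unfolding h_def by (rule mult_left_mono)
  finally show ?case by (simp add: mult_ac)
qed

theorem (in invariant_kernel) op_norm_imp_L2_geometrically_convergent:
  assumes t: "t > 0" and op: "op_norm M (kernel_pow M K t) < 1"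
  shows "L2_geometrically_convergent M K"
proof -
  obtain r where r: "0 < r" "r < 1" and
    K: "\<And>g. g \<in> L2_0 M \<Longrightarrow> (\<integral>x. (kernel_apply (kernel_pow M K t) g x)\<^sup>2 \<partial>M) \<le> r * (\<integral>x. (g x)\<^sup>2 \<partial>M)"
    using op_norm_less_1D[OF invariant_kernel_pow op] by metis
  \<comment> \<open>Squared norms shrink by \<open>r\<close> in \<open>t\<close> steps, so norms
    shrink by the root of order \<open>2 * t\<close> per step. Replacing \<open>n div t\<close> by
    \<open>n / t - 1\<close> costs a factor \<open>1 / r\<close> for squared norms, which becomes
    \<open>sqrt (1 / r)\<close> in the constant.\<close>
  define \<rho> where "\<rho> = r powr (1 / (2 * real t))"
  have \<rho>: "0 < \<rho>" "\<rho> < 1" using r t powr_less_mono2[of "1 / (2 * real t)" r 1] by (auto simp: \<rho>_def)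
  have "L2_dist M (mu \<bind> kernel_pow M K n) M \<le> (sqrt (1 / r) * L2_dist M mu M) * \<rho> ^ n"
    if mu: "mu \<in> L2_star M" for mu n
  proof -
    interpret n: invariant_kernel M "kernel_pow M K n" by (rule invariant_kernel_pow)
    have "r ^ (n div t) = r powr real (n div t)" using r by (simp add: powr_realpow)
    also have "\<dots> \<le> r powr (real n / real t - 1)"
    proof (rule powr_mono')
      have "real n = real (n div t) * real t + real (n mod t)"
        by (metis div_mult_mod_eq of_nat_add of_nat_mult)
      also have "\<dots> \<le> real (n div t) * real t + real t" using t by (simp add: less_imp_le)
      finally show "real n / real t - 1 \<le> real (n div t)" using t by (simp add: field_simps)
    qed (use r in auto)
    also have "\<dots> = (1 / r) * (\<rho> ^ n)\<^sup>2"
      using r t by (simp add: \<rho>_def powr_diff powr_powr flip: powr_realpow power_mult)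
    finally have le: "r ^ (n div t) \<le> (1 / r) * (\<rho> ^ n)\<^sup>2" .
    \<comment> \<open>The adjoint estimate is applied once, to the kernel of \<open>n\<close> steps,
      not step by step to the measures.\<close>
    have "(L2_dist M (mu \<bind> kernel_pow M K n) M)\<^sup>2 \<le> r ^ (n div t) * (L2_dist M mu M)\<^sup>2"
    proof (rule n.L2_dist_bind_le[OF mu])
      show "0 < r ^ (n div t)" using r by simp
      show "(\<integral>x. (kernel_apply (kernel_pow M K n) g x)\<^sup>2 \<partial>M) \<le> r ^ (n div t) * (\<integral>x. (g x)\<^sup>2 \<partial>M)"
        if "g \<in> L2_0 M" for g
        using kernel_pow_block_bound[OF _ K that, of "n div t" "n mod t"] r by simp
    qed
    also have "\<dots> \<le> ((1 / r) * (\<rho> ^ n)\<^sup>2) * (L2_dist M mu M)\<^sup>2"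
      using le by (rule mult_right_mono) simp
    also have "\<dots> = ((sqrt (1 / r) * L2_dist M mu M) * \<rho> ^ n)\<^sup>2"
      using r by (simp add: power_mult_distrib)
    finally show ?thesis
      by (rule power2_le_imp_le) (use r \<rho> in \<open>auto simp: L2_dist_def L2_norm_def\<close>)
  qed
  moreover have "0 \<le> sqrt (1 / r) * L2_dist M mu M" for mu
    using r by (simp add: L2_dist_def L2_norm_def)
  ultimately show ?thesis
    unfolding L2_geometrically_convergent_def using \<rho>
    by (intro exI[of _ \<rho>] conjI exI[of _ "\<lambda>mu. sqrt (1 / r) * L2_dist M mu M"]) auto
qed

section \<open>Kernels on finite mixtures\<close>

text \<open>To be applied with \<open>\<phi>\<close> the inclusion of a component, and with
  \<open>Q\<close> and \<open>R\<close> the values of the component kernel and of the full kernel at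
  one point.\<close>

lemma dominated_integral:
  fixes g :: "'b \<Rightarrow> real"
  assumes phi [measurable]: "\<phi> \<in> Q \<rightarrow>\<^sub>M R" and c: "0 < c"
    and dom: "\<And>g. g \<in> borel_measurable R \<Longrightarrow> ennreal c * (\<integral>\<^sup>+z. g (\<phi> z) \<partial>Q) \<le> (\<integral>\<^sup>+x. g x \<partial>R)"
    and g: "integrable R g" "\<And>x. 0 \<le> g x"
  shows "integrable Q (\<lambda>z. g (\<phi> z))" "c * (\<integral>z. g (\<phi> z) \<partial>Q) \<le> (\<integral>x. g x \<partial>R)"
proof -
  have [measurable]: "g \<in> borel_measurable R" using g by auto
  have *: "ennreal c * (\<integral>\<^sup>+z. ennreal (g (\<phi> z)) \<partial>Q) \<le> ennreal (\<integral>x. g x \<partial>R)"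
    using dom[of "\<lambda>x. ennreal (g x)"] g by (simp add: nn_integral_eq_integral)
  also have "\<dots> < \<infinity>" by simp
  finally have "(\<integral>\<^sup>+z. ennreal (g (\<phi> z)) \<partial>Q) < \<infinity>"
    using c by (auto simp: ennreal_mult_less_top)
  thus i: "integrable Q (\<lambda>z. g (\<phi> z))"
    using g by (intro integrableI_nonneg) auto
  show "c * (\<integral>z. g (\<phi> z) \<partial>Q) \<le> (\<integral>x. g x \<partial>R)"
    using * c g i by (simp add: nn_integral_eq_integral integral_nonneg_AE ennreal_mult'[symmetric])
qed

text \<open>With \<open>a\<close> the mean under \<open>R\<close>, Jensen's inequality under
  \<open>Q\<close> bounds the squared difference of the means by the \<open>Q\<close>-mean of
  \<open>(f - a)\<^sup>2\<close>; domination compares this with the variance under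
  \<open>R\<close>.\<close>

lemma dominated_mean_deviation:
  assumes "prob_space Q" "prob_space R"
    and phi [measurable]: "\<phi> \<in> Q \<rightarrow>\<^sub>M R" and c: "0 < c"
    and dom: "\<And>g. g \<in> borel_measurable R \<Longrightarrow> ennreal c * (\<integral>\<^sup>+z. g (\<phi> z) \<partial>Q) \<le> (\<integral>\<^sup>+x. g x \<partial>R)"
    and f: "f \<in> L2 R"
  shows "c * ((\<integral>x. f x \<partial>R) - (\<integral>z. f (\<phi> z) \<partial>Q))\<^sup>2 \<le> (\<integral>x. (f x)\<^sup>2 \<partial>R) - (\<integral>x. f x \<partial>R)\<^sup>2"
proof -
  interpret Q: prob_space Q by fact
  interpret R: prob_space R by fact
  define a where "a = (\<integral>x. f x \<partial>R)"
  have [measurable]: "f \<in> borel_measurable R" using f by (simp add: L2_def)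
  have g: "(\<lambda>x. f x - a) \<in> L2 R" using f R.L2_const by (rule L2_diff)
  note d = dominated_integral[OF phi c dom, of "\<lambda>x. (f x - a)\<^sup>2"]
  have L: "(\<lambda>z. f (\<phi> z) - a) \<in> L2 Q" using d(1) g by (simp add: L2_def)
  have "integrable Q (\<lambda>z. f (\<phi> z))"
    using Bochner_Integration.integrable_add[OF L2_integrable[OF Q.finite_measure_axioms L] Q.integrable_const[of a]] by simp
  hence "(\<integral>z. f (\<phi> z) - a \<partial>Q) = (\<integral>z. f (\<phi> z) \<partial>Q) - a" by (simp add: Q.prob_space)
  hence "((\<integral>z. f (\<phi> z) \<partial>Q) - a)\<^sup>2 \<le> (\<integral>z. (f (\<phi> z) - a)\<^sup>2 \<partial>Q)"
    using Q.integral_square_le[OF L] by simp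
  hence "c * ((\<integral>z. f (\<phi> z) \<partial>Q) - a)\<^sup>2 \<le> c * (\<integral>z. (f (\<phi> z) - a)\<^sup>2 \<partial>Q)" using c by simp
  also have "\<dots> \<le> (\<integral>x. (f x - a)\<^sup>2 \<partial>R)" using d(2) g by (simp add: L2_def)
  also have "\<dots> = (\<integral>x. (f x)\<^sup>2 \<partial>R) - a\<^sup>2"
    unfolding a_def using f L2_integrable[OF R.finite_measure_axioms f] by (intro R.variance_eq) (auto simp: L2_def)
  finally show ?thesis by (simp add: a_def power2_commute)
qed

section \<open>Finite mixtures and dominating kernels\<close>

text \<open>Of the disjoint union only the integral formula and the measurability of inclusions and
  labels are kept, so the analysis is free of generators and of unnormalized measures.\<close>

locale mixture =
  fixes w :: "'k::finite \<Rightarrow> real" and Phi :: "'k \<Rightarrow> 'z measure" and U :: "('k \<times> 'z) measure"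
  assumes w_pos: "0 < w k"
    and prob_component: "prob_space (Phi k)"
    and Pair_measurable [measurable]: "Pair k \<in> Phi k \<rightarrow>\<^sub>M U"
    and fst_measurable [measurable]: "fst \<in> U \<rightarrow>\<^sub>M count_space UNIV"
    and nn_integral_mixture:
      "f \<in> borel_measurable U \<Longrightarrow> (\<integral>\<^sup>+x. f x \<partial>U) = (\<Sum>k\<in>UNIV. ennreal (w k) * (\<integral>\<^sup>+z. f (k, z) \<partial>Phi k))"
begin

lemma measurable_component:
  "f \<in> borel_measurable U \<Longrightarrow> (\<lambda>z. f (k, z)) \<in> borel_measurable (Phi k)"
  using measurable_compose[OF Pair_measurable] .

lemma ennreal_w_nonzero [simp]: "ennreal (w k) \<noteq> 0"
  using w_pos[of k] by simp

lemma AE_component: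
  assumes "AE x in U. Q x" shows "AE z in Phi k. Q (k, z)"
proof -
  obtain N where N: "{x \<in> space U. \<not> Q x} \<subseteq> N" "N \<in> null_sets U"
    using assms by (auto simp: eventually_ae_filter)
  hence [measurable]: "N \<in> sets U" by auto
  have "(\<Sum>k\<in>UNIV. ennreal (w k) * (\<integral>\<^sup>+z. indicator N (k, z) \<partial>Phi k)) = 0"
    using N by (subst nn_integral_mixture[symmetric]) auto
  hence "(\<integral>\<^sup>+z. indicator N (k, z) \<partial>Phi k) = 0"
    by (simp add: sum_eq_0_iff)
  hence "AE z in Phi k. indicator N (k, z) = (0::ennreal)"
    by (subst (asm) nn_integral_0_iff_AE) (auto intro: measurable_component)
  with AE_space show ?thesis
  proof eventually_elim
    case (elim z)
    hence "(k, z) \<in> space U" "(k, z) \<notin> N"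
      using measurable_space[OF Pair_measurable] by (auto simp: indicator_def split: if_splits)
    thus ?case using N by auto
  qed
qed

lemma integrable_component:
  fixes f :: "'k \<times> 'z \<Rightarrow> real"
  assumes "integrable U f" shows "integrable (Phi k) (\<lambda>z. f (k, z))"
proof -
  have [measurable]: "f \<in> borel_measurable U" using assms by auto
  have "(\<Sum>k\<in>UNIV. ennreal (w k) * (\<integral>\<^sup>+z. ennreal \<bar>f (k, z)\<bar> \<partial>Phi k)) < \<infinity>"
    using assms by (subst nn_integral_mixture[symmetric]) (auto simp: integrable_iff_bounded)
  hence "(\<integral>\<^sup>+z. ennreal \<bar>f (k, z)\<bar> \<partial>Phi k) < \<infinity>"
    by (auto simp: ennreal_mult_less_top dest!: spec[of _ k])
  thus ?thesis using measurable_component[of f k] by (simp add: integrable_iff_bounded)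
qed

lemma integral_mixture:
  fixes f :: "'k \<times> 'z \<Rightarrow> real"
  assumes f: "integrable U f" shows "(\<integral>x. f x \<partial>U) = (\<Sum>k\<in>UNIV. w k * (\<integral>z. f (k, z) \<partial>Phi k))"
proof -
  have nonneg: "(\<integral>x. p x \<partial>U) = (\<Sum>k\<in>UNIV. w k * (\<integral>z. p (k, z) \<partial>Phi k))"
    if p: "integrable U p" "\<And>x. 0 \<le> p x" for p :: "'k \<times> 'z \<Rightarrow> real"
  proof -
    have "ennreal (\<integral>x. p x \<partial>U) = (\<Sum>k\<in>UNIV. ennreal (w k) * (\<integral>\<^sup>+z. ennreal (p (k, z)) \<partial>Phi k))"
      using p by (subst nn_integral_mixture[symmetric]) (auto simp: nn_integral_eq_integral)
    also have "\<dots> = ennreal (\<Sum>k\<in>UNIV. w k * (\<integral>z. p (k, z) \<partial>Phi k))"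
      using p integrable_component[OF p(1)] w_pos
      by (subst sum_ennreal[symmetric])
        (auto simp: nn_integral_eq_integral integral_nonneg_AE less_imp_le ennreal_mult'
          intro!: sum.cong mult_nonneg_nonneg)
    finally show ?thesis
      using p w_pos by (subst (asm) ennreal_inj) (auto simp: integral_nonneg_AE less_imp_le intro!: sum_nonneg mult_nonneg_nonneg)
  qed
  define p n where "p = (\<lambda>x. max 0 (f x))" and "n = (\<lambda>x. max 0 (- f x))"
  have pn: "integrable U p" "integrable U n" "\<And>x. 0 \<le> p x" "\<And>x. 0 \<le> n x"
    using f by (auto simp: p_def n_def)
  have f_eq: "f = (\<lambda>x. p x - n x)" by (auto simp: p_def n_def)
  show ?thesis
    using pn integrable_component[OF pn(1)] integrable_component[OF pn(2)] nonneg[OF pn(1,3)] nonneg[OF pn(2,4)]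
    by (simp add: f_eq right_diff_distrib sum_subtractf)
qed

lemma L2_component: "f \<in> L2 U \<Longrightarrow> (\<lambda>z. f (k, z)) \<in> L2 (Phi k)"
  using integrable_component[of "\<lambda>x. (f x)\<^sup>2" k] measurable_component[of f k] by (auto simp: L2_def)

lemma L2_mixture:
  assumes "f \<in> L2 U"
  shows "(\<integral>x. (f x)\<^sup>2 \<partial>U) = (\<Sum>k\<in>UNIV. w k * (\<integral>z. (f (k, z))\<^sup>2 \<partial>Phi k))"
  using assms by (intro integral_mixture) (simp add: L2_def)

lemma weighted_sum_mono: "(\<And>k. a k \<le> b k) \<Longrightarrow> (\<Sum>k\<in>UNIV. w k * a k) \<le> (\<Sum>k\<in>UNIV. w k * b k)"
  using w_pos by (intro sum_mono mult_left_mono) (auto simp: less_imp_le)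

end

text \<open>One constant \<open>c\<close> serves all components, as there are finitely many.
  Domination is put in terms of nonnegative functions, the form in which it is used;
  \<open>domination_nn_integral\<close> derives it from sets.\<close>

locale kernel_on_mixture = mixture w Phi U + invariant_kernel U P
  for w :: "'k::finite \<Rightarrow> real" and Phi :: "'k \<Rightarrow> 'z measure" and U P +
  fixes Q :: "'k \<Rightarrow> 'z \<Rightarrow> 'z measure" and c :: real
  assumes component_kernel: "invariant_kernel (Phi k) (Q k)"
    and c_pos: "0 < c"
    and domination: "z \<in> space (Phi k) \<Longrightarrow> g \<in> borel_measurable U \<Longrightarrow>
      ennreal c * (\<integral>\<^sup>+z'. g (k, z') \<partial>Q k z) \<le> (\<integral>\<^sup>+x. g x \<partial>P (k, z))"
begin

lemma sum_w: "(\<Sum>k\<in>UNIV. w k) = 1"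
  using integral_mixture[of "\<lambda>_. 1"] by (simp add: prob_space prob_space.prob_space[OF prob_component])

text \<open>This is the variance of \<open>f\<close> under \<open>P x\<close> wherever
  \<open>f\<close> is square integrable under \<open>P x\<close>, thus almost everywhere if
  \<open>f\<close> lies in \<open>L2 U\<close>.\<close>

definition Var :: "('k \<times> 'z \<Rightarrow> real) \<Rightarrow> 'k \<times> 'z \<Rightarrow> real" where
  "Var f x = kernel_apply P (\<lambda>y. (f y)\<^sup>2) x - (kernel_apply P f x)\<^sup>2"

lemma Var_integral:
  assumes "f \<in> L2 U"
  shows "integrable U (Var f)" "(\<integral>x. Var f x \<partial>U) = (\<integral>x. (f x)\<^sup>2 \<partial>U) - (\<integral>x. (kernel_apply P f x)\<^sup>2 \<partial>U)"
  using kernel_variance_integral[OF assms] by (simp_all add: Var_def[abs_def])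

lemma AE_L2_kernel:
  assumes "f \<in> L2 U"
  shows "AE x in U. f \<in> L2 (P x)"
proof -
  have "integrable U (\<lambda>x. (f x)\<^sup>2)" "f \<in> borel_measurable U" using assms by (auto simp: L2_def)
  with AE_kernel_integrable[of "\<lambda>x. (f x)\<^sup>2"] AE_space show ?thesis
    by (auto simp: L2_def measurable_kernel_eq)
qed

text \<open>The component kernel averages over a part, of weight at least \<open>c\<close>, of what \<open>P\<close> averages over,
  so its mean cannot be far from that of \<open>P\<close> unless \<open>f\<close> varies under \<open>P\<close>.\<close>

lemma component_deviation:
  assumes f: "f \<in> L2 U"
  shows "AE z in Phi k. c * (kernel_apply P f (k, z) - kernel_apply (Q k) (\<lambda>z. f (k, z)) z)\<^sup>2 \<le> Var f (k, z)"
proof -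
  interpret k: invariant_kernel "Phi k" "Q k" by (rule component_kernel)
  have "AE z in Phi k. f \<in> L2 (P (k, z))" by (rule AE_component[OF AE_L2_kernel[OF f]])
  with AE_space show ?thesis
  proof eventually_elim
    case (elim z)
    have kz: "(k, z) \<in> space U" using elim(1) measurable_space[OF Pair_measurable] by auto
    have "Pair k \<in> Q k z \<rightarrow>\<^sub>M P (k, z)"
      using Pair_measurable[of k] elim(1) kz
      by (simp cong: measurable_cong_sets add: k.sets_kernel_eq sets_kernel_eq)
    from dominated_mean_deviation[OF k.prob_space_kernel[OF elim(1)] prob_space_kernel[OF kz] this c_pos _ elim(2)]
    show ?case
      using domination[OF elim(1)] kz by (simp add: measurable_kernel_eq kernel_apply_def Var_def)
  qed
qed

lemma component_deviation_integral:
  assumes f: "f \<in> L2 U"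
  shows "(\<Sum>k\<in>UNIV. w k * (\<integral>z. (kernel_apply P f (k, z) - kernel_apply (Q k) (\<lambda>z. f (k, z)) z)\<^sup>2 \<partial>Phi k))
    \<le> ((\<integral>x. (f x)\<^sup>2 \<partial>U) - (\<integral>x. (kernel_apply P f x)\<^sup>2 \<partial>U)) / c"
proof -
  have i: "integrable (Phi k) (\<lambda>z. (kernel_apply P f (k, z) - kernel_apply (Q k) (\<lambda>z. f (k, z)) z)\<^sup>2)" for k
  proof -
    interpret k: invariant_kernel "Phi k" "Q k" by (rule component_kernel)
    show ?thesis
      using L2_diff[OF L2_component[OF kernel_apply_L2[OF f]] k.kernel_apply_L2[OF L2_component[OF f]]]
      by (simp add: L2_def)
  qed
  have "(\<integral>z. (kernel_apply P f (k, z) - kernel_apply (Q k) (\<lambda>z. f (k, z)) z)\<^sup>2 \<partial>Phi k)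
      \<le> (\<integral>z. Var f (k, z) / c \<partial>Phi k)" for k
  proof (rule integral_mono_AE[OF i])
    show "integrable (Phi k) (\<lambda>z. Var f (k, z) / c)"
      using integrable_component[OF Var_integral(1)[OF f]] by auto
    show "AE z in Phi k. (kernel_apply P f (k, z) - kernel_apply (Q k) (\<lambda>z. f (k, z)) z)\<^sup>2 \<le> Var f (k, z) / c"
      using component_deviation[OF f, of k] by (rule eventually_mono) (use c_pos in \<open>simp add: field_simps\<close>)
  qed
  hence "(\<Sum>k\<in>UNIV. w k * (\<integral>z. (kernel_apply P f (k, z) - kernel_apply (Q k) (\<lambda>z. f (k, z)) z)\<^sup>2 \<partial>Phi k))
    \<le> (\<Sum>k\<in>UNIV. w k * (\<integral>z. Var f (k, z) / c \<partial>Phi k))" by (rule weighted_sum_mono)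
  also have "\<dots> = (\<integral>x. Var f x / c \<partial>U)"
    using Var_integral(1)[OF f] by (subst integral_mixture) auto
  also have "\<dots> = ((\<integral>x. (f x)\<^sup>2 \<partial>U) - (\<integral>x. (kernel_apply P f x)\<^sup>2 \<partial>U)) / c"
    by (simp add: Var_integral(2)[OF f])
  finally show ?thesis .
qed

section \<open>Norm loss and comparison of iterates\<close>

text \<open>The currency of the proof: all errors are bounded by multiples of it.
  \<open>deficit_Suc\<close> telescopes it into one-step losses, each of which is a mean
  variance.\<close>

definition deficit :: "nat \<Rightarrow> ('k \<times> 'z \<Rightarrow> real) \<Rightarrow> real" where
  "deficit n f = (\<integral>x. (f x)\<^sup>2 \<partial>U) - (\<integral>x. (kernel_apply (kernel_pow U P n) f x)\<^sup>2 \<partial>U)"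

lemma kernel_pow_L2: "f \<in> L2 U \<Longrightarrow> kernel_apply (kernel_pow U P n) f \<in> L2 U"
  by (rule invariant_kernel.kernel_apply_L2[OF invariant_kernel_pow])

lemma deficit_nonneg: "f \<in> L2 U \<Longrightarrow> 0 \<le> deficit n f"
  using invariant_kernel.kernel_apply_contraction[OF invariant_kernel_pow, of f] by (simp add: deficit_def)

lemma deficit_Suc:
  fixes n :: nat
  assumes f: "f \<in> L2 U"
  defines "F \<equiv> kernel_apply (kernel_pow U P n) f"
  shows "deficit (Suc n) f = deficit n f + ((\<integral>x. (F x)\<^sup>2 \<partial>U) - (\<integral>x. (kernel_apply P F x)\<^sup>2 \<partial>U))"
proof -
  have [measurable]: "F \<in> borel_measurable U" "f \<in> borel_measurable U" 
    using f kernel_pow_L2[OF f] by (auto simp: F_def L2_def)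
  have "(\<integral>x. (kernel_apply (kernel_pow U P (Suc n)) f x)\<^sup>2 \<partial>U) = (\<integral>x. (kernel_apply P F x)\<^sup>2 \<partial>U)"
    using kernel_pow_apply_Suc[OF L2_integrable[OF finite_measure_axioms f], of n] unfolding F_def[symmetric]
    by (intro integral_cong_AE borel_measurable_power kernel_pow_measurable) (auto elim!: eventually_mono)
  thus ?thesis by (simp add: deficit_def F_def)
qed

lemma deficit_mono:
  assumes f: "f \<in> L2 U" and "m \<le> n"
  shows "deficit m f \<le> deficit n f"
  using \<open>m \<le> n\<close>
proof (induction rule: dec_induct)
  case (step n)
  show ?case
    using step deficit_Suc[OF f, of n] kernel_apply_contraction[OF kernel_pow_L2[OF f, of n]] by simp
qed simp

text \<open>Compares \<open>n\<close> steps of \<open>P\<close> with \<open>n\<close> steps of the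
  block-diagonal kernel that moves by \<open>Q k\<close> and never leaves component
  \<open>k\<close>.\<close>

definition split_error :: "nat \<Rightarrow> ('k \<times> 'z \<Rightarrow> real) \<Rightarrow> real" where
  "split_error n f = (\<Sum>k\<in>UNIV. w k * (\<integral>z. (kernel_apply (kernel_pow U P n) f (k, z)
     - kernel_apply (kernel_pow (Phi k) (Q k) n) (\<lambda>z. f (k, z)) z)\<^sup>2 \<partial>Phi k))"

text \<open>With \<open>F\<close> and \<open>G\<close> the iterates after \<open>n\<close> steps, P
  F - Q G = (P F - Q F) + Q (F - G). The first part is a one-step deviation, controlled by the
  increment of the deficit; the second is no larger than F - G because \<open>Q k\<close>
  contracts.\<close>

lemma split_error_Suc_le:
  assumes f: "f \<in> L2 U"
  shows "split_error (Suc n) f \<le> 2 / c * deficit (Suc n) f + 2 * split_error n f"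
proof -
  define F where "F = kernel_apply (kernel_pow U P n) f"
  define G where "G k = kernel_apply (kernel_pow (Phi k) (Q k) n) (\<lambda>z. f (k, z))" for k
  define A where "A k z = kernel_apply P F (k, z) - kernel_apply (Q k) (\<lambda>z. F (k, z)) z" for k z
  have F: "F \<in> L2 U" unfolding F_def by (rule kernel_pow_L2[OF f])
  have "(\<integral>z. (kernel_apply (kernel_pow U P (Suc n)) f (k, z)
     - kernel_apply (kernel_pow (Phi k) (Q k) (Suc n)) (\<lambda>z. f (k, z)) z)\<^sup>2 \<partial>Phi k)
     \<le> 2 * (\<integral>z. (A k z)\<^sup>2 \<partial>Phi k) + 2 * (\<integral>z. (F (k, z) - G k z)\<^sup>2 \<partial>Phi k)" for k
  proof -
    interpret k: invariant_kernel "Phi k" "Q k" by (rule component_kernel)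
    interpret kn: invariant_kernel "Phi k" "kernel_pow (Phi k) (Q k) n" by (rule k.invariant_kernel_pow)
    have fk: "(\<lambda>z. f (k, z)) \<in> L2 (Phi k)" by (rule L2_component[OF f])
    have Fk: "(\<lambda>z. F (k, z)) \<in> L2 (Phi k)" by (rule L2_component[OF F])
    have Gk: "G k \<in> L2 (Phi k)" unfolding G_def by (rule kn.kernel_apply_L2[OF fk])
    define B where "B z = F (k, z) - G k z" for z
    have B: "B \<in> L2 (Phi k)" unfolding B_def by (rule L2_diff[OF Fk Gk])
    have A: "A k \<in> L2 (Phi k)"
      unfolding A_def by (rule L2_diff[OF L2_component[OF kernel_apply_L2[OF F]] k.kernel_apply_L2[OF Fk]])
    have KB: "kernel_apply (Q k) B \<in> L2 (Phi k)" by (rule k.kernel_apply_L2[OF B])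
    note integrable = L2_integrable[OF k.finite_measure_axioms]
    have "AE z in Phi k. kernel_apply (kernel_pow U P (Suc n)) f (k, z) = kernel_apply P F (k, z)"
      unfolding F_def
      by (rule AE_component[OF kernel_pow_apply_Suc[OF L2_integrable[OF finite_measure_axioms f]]])
    moreover have "AE z in Phi k. kernel_apply (kernel_pow (Phi k) (Q k) (Suc n)) (\<lambda>z. f (k, z)) z
        = kernel_apply (Q k) (G k) z"
      unfolding G_def by (rule k.kernel_pow_apply_Suc[OF integrable[OF fk]])
    ultimately have ae: "AE z in Phi k. kernel_apply (kernel_pow U P (Suc n)) f (k, z)
       - kernel_apply (kernel_pow (Phi k) (Q k) (Suc n)) (\<lambda>z. f (k, z)) z = A k z + kernel_apply (Q k) B z"
      using k.AE_kernel_integrable[OF integrable[OF Fk]] k.AE_kernel_integrable[OF integrable[OF Gk]]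
      by eventually_elim (simp add: A_def B_def[abs_def] kernel_apply_def)
    have m: "(\<lambda>z. kernel_apply (kernel_pow U P (Suc n)) f (k, z)
       - kernel_apply (kernel_pow (Phi k) (Q k) (Suc n)) (\<lambda>z. f (k, z)) z) \<in> borel_measurable (Phi k)"
      using f fk unfolding L2_def
      by (intro borel_measurable_diff measurable_component kernel_pow_measurable k.kernel_pow_measurable) auto
    have "(\<integral>z. (kernel_apply (kernel_pow U P (Suc n)) f (k, z)
       - kernel_apply (kernel_pow (Phi k) (Q k) (Suc n)) (\<lambda>z. f (k, z)) z)\<^sup>2 \<partial>Phi k)
       = (\<integral>z. (A k z + kernel_apply (Q k) B z)\<^sup>2 \<partial>Phi k)"
      using ae m L2_add[OF A KB] by (intro integral_cong_AE) (auto simp: L2_def elim!: eventually_mono)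
    also have "\<dots> \<le> 2 * (\<integral>z. (A k z)\<^sup>2 \<partial>Phi k) + 2 * (\<integral>z. (kernel_apply (Q k) B z)\<^sup>2 \<partial>Phi k)"
      using L2_square_sum_le[OF A KB, of 1] by simp
    also have "(\<integral>z. (kernel_apply (Q k) B z)\<^sup>2 \<partial>Phi k) \<le> (\<integral>z. (B z)\<^sup>2 \<partial>Phi k)"
      by (rule k.kernel_apply_contraction[OF B])
    finally show ?thesis by (simp add: B_def)
  qed
  hence "split_error (Suc n) f \<le> (\<Sum>k\<in>UNIV. w k * (2 * (\<integral>z. (A k z)\<^sup>2 \<partial>Phi k) + 2 * (\<integral>z. (F (k, z) - G k z)\<^sup>2 \<partial>Phi k)))"
    unfolding split_error_def by (rule weighted_sum_mono)
  also have "\<dots> = 2 * (\<Sum>k\<in>UNIV. w k * (\<integral>z. (A k z)\<^sup>2 \<partial>Phi k)) + 2 * split_error n f"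
    by (simp add: split_error_def F_def G_def sum_distrib_left sum.distrib algebra_simps)
  also have "(\<Sum>k\<in>UNIV. w k * (\<integral>z. (A k z)\<^sup>2 \<partial>Phi k)) \<le> (deficit (Suc n) f - deficit n f) / c"
    using component_deviation_integral[OF F] unfolding A_def deficit_Suc[OF f] F_def by simp
  also have "\<dots> \<le> deficit (Suc n) f / c"
    using deficit_nonneg[OF f, of n] c_pos by (intro divide_right_mono) auto
  finally show ?thesis by simp
qed

text \<open>The constant obeys e' = 2 / c + 2 e and grows like 2^n, which is harmless for a fixed
  \<open>n\<close>; what matters is that it is independent of \<open>f\<close>.\<close>

lemma split_error_le: "\<exists>e\<ge>0. \<forall>f\<in>L2 U. split_error n f \<le> e * deficit n f"
proof (induction n)
  case 0
  have "split_error 0 f = 0" if "f \<in> L2 U" for f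
  proof -
    have "(\<integral>z. (kernel_apply (kernel_pow U P 0) f (k, z)
     - kernel_apply (kernel_pow (Phi k) (Q k) 0) (\<lambda>z. f (k, z)) z)\<^sup>2 \<partial>Phi k) = (\<integral>z. 0 \<partial>Phi k)" for k
    proof (rule Bochner_Integration.integral_cong)
      fix z assume z: "z \<in> space (Phi k)"
      interpret k: invariant_kernel "Phi k" "Q k" by (rule component_kernel)
      have "(k, z) \<in> space U" using z measurable_space[OF Pair_measurable] by auto
      thus "(kernel_apply (kernel_pow U P 0) f (k, z)
     - kernel_apply (kernel_pow (Phi k) (Q k) 0) (\<lambda>z. f (k, z)) z)\<^sup>2 = 0"
        using z that L2_component[OF that, of k] by (subst kernel_pow_apply_0) (auto simp del: kernel_pow.simps simp: L2_def k.kernel_pow_apply_0)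
    qed simp
    thus ?thesis by (simp add: split_error_def)
  qed
  thus ?case by (intro exI[of _ 0]) simp
next
  case (Suc n)
  then obtain e where e: "0 \<le> e" "\<And>f. f \<in> L2 U \<Longrightarrow> split_error n f \<le> e * deficit n f" by auto
  show ?case
  proof (intro exI[of _ "2 / c + 2 * e"] conjI ballI)
    show "0 \<le> 2 / c + 2 * e" using e c_pos by simp
    fix f assume f: "f \<in> L2 U"
    have "e * deficit n f \<le> e * deficit (Suc n) f" using e deficit_mono[OF f] by (intro mult_left_mono) auto
    thus "split_error (Suc n) f \<le> (2 / c + 2 * e) * deficit (Suc n) f"
      using split_error_Suc_le[OF f, of n] e(2)[OF f] by (simp add: algebra_simps)
  qed
qed

end

lemma four_squares: "(a + b + p + q :: real)\<^sup>2 \<le> 4 * (a\<^sup>2 + b\<^sup>2 + p\<^sup>2 + q\<^sup>2)"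
proof -
  have "4 * (a\<^sup>2 + b\<^sup>2 + p\<^sup>2 + q\<^sup>2) - (a + b + p + q)\<^sup>2
    = (a - b)\<^sup>2 + (a - p)\<^sup>2 + (a - q)\<^sup>2 + (b - p)\<^sup>2 + (b - q)\<^sup>2 + (p - q)\<^sup>2"
    by (simp add: power2_eq_square algebra_simps)
  also have "\<dots> \<ge> 0" by simp
  finally show ?thesis by simp
qed

section \<open>Variance inside the components\<close>

context mixture
begin

definition component_mean :: "('k \<times> 'z \<Rightarrow> real) \<Rightarrow> 'k \<Rightarrow> real" where
  "component_mean f k = (\<integral>z. f (k, z) \<partial>Phi k)"

definition within_variance :: "('k \<times> 'z \<Rightarrow> real) \<Rightarrow> real" where
  "within_variance f = (\<Sum>k\<in>UNIV. w k * (\<integral>z. (f (k, z) - component_mean f k)\<^sup>2 \<partial>Phi k))"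

lemma component_centered_L2_0:
  assumes "f \<in> L2 U" shows "(\<lambda>z. f (k, z) - component_mean f k) \<in> L2_0 (Phi k)"
proof -
  interpret k: prob_space "Phi k" by (rule prob_component)
  have f: "(\<lambda>z. f (k, z)) \<in> L2 (Phi k)" by (rule L2_component[OF assms])
  have "(\<lambda>z. f (k, z) - component_mean f k) \<in> L2 (Phi k)" using f k.L2_const by (rule L2_diff)
  thus ?thesis
    using L2_integrable[OF k.finite_measure_axioms f]
    by (simp add: L2_0_def component_mean_def k.prob_space)
qed

lemma component_pythagoras:
  assumes "f \<in> L2 U"
  shows "(\<integral>z. (f (k, z))\<^sup>2 \<partial>Phi k)
    = (component_mean f k)\<^sup>2 + (\<integral>z. (f (k, z) - component_mean f k)\<^sup>2 \<partial>Phi k)"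
proof -
  interpret k: prob_space "Phi k" by (rule prob_component)
  have f: "(\<lambda>z. f (k, z)) \<in> L2 (Phi k)" by (rule L2_component[OF assms])
  show ?thesis
    using k.variance_eq[of "\<lambda>z. f (k, z)"] f L2_integrable[OF k.finite_measure_axioms f]
    by (simp add: L2_def component_mean_def)
qed

lemma within_variance_decomp:
  assumes "f \<in> L2 U"
  shows "(\<integral>x. (f x)\<^sup>2 \<partial>U) = (\<Sum>k\<in>UNIV. w k * (component_mean f k)\<^sup>2) + within_variance f"
  by (simp add: L2_mixture[OF assms] component_pythagoras[OF assms] within_variance_def
      sum.distrib distrib_left)

lemma within_variance_nonneg: "0 \<le> within_variance f"
  unfolding within_variance_def using w_pos by (intro sum_nonneg mult_nonneg_nonneg) (auto simp: less_imp_le)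

lemma mean_sq_nonneg: "0 \<le> (\<Sum>k\<in>UNIV. w k * (h k)\<^sup>2)"
  using w_pos by (intro sum_nonneg mult_nonneg_nonneg) (auto simp: less_imp_le)

end

context kernel_on_mixture
begin

text \<open>Let H and V be the parts of ||f||^2 between and inside the components. The gap gives at
  most H + r V for the block-diagonal iterate, hence ||f||^2 - deficit <= (1 + \<theta>) (H + r V) +
  O(deficit). Since ||f||^2 = H + V, all of H cancels except \<theta> H, and (1 - r) V <= \<theta>
  ||f||^2 + O(deficit) remains.\<close>

lemma within_variance_le:
  assumes r: "0 \<le> r" "r < 1"
    and gap: "\<And>k g. g \<in> L2_0 (Phi k) \<Longrightarrow>
      (\<integral>z. (kernel_apply (kernel_pow (Phi k) (Q k) n) g z)\<^sup>2 \<partial>Phi k) \<le> r * (\<integral>z. (g z)\<^sup>2 \<partial>Phi k)"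
    and \<eta>: "0 < \<eta>"
  shows "\<exists>C\<ge>0. \<forall>f\<in>L2 U. within_variance f \<le> \<eta> * (\<integral>x. (f x)\<^sup>2 \<partial>U) + C * deficit n f"
proof -
  obtain e where e: "0 \<le> e" "\<And>f. f \<in> L2 U \<Longrightarrow> split_error n f \<le> e * deficit n f"
    using split_error_le by blast
  \<comment> \<open>Dividing by \<open>1 - r\<close> at the end turns \<open>\<theta>\<close> into
    \<open>\<eta>\<close>.\<close>
  define \<theta> where "\<theta> = \<eta> * (1 - r)"
  have \<theta>: "0 < \<theta>" using \<eta> r by (simp add: \<theta>_def)
  define C where "C = 1 + (1 + 1 / \<theta>) * e"
  have C: "0 \<le> C" using \<theta> e by (simp add: C_def)
  have main: "within_variance f \<le> \<eta> * (\<integral>x. (f x)\<^sup>2 \<partial>U) + C / (1 - r) * deficit n f" if f: "f \<in> L2 U" for f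
  proof -
    define h where "h = component_mean f"
    define H where "H = (\<Sum>k\<in>UNIV. w k * (h k)\<^sup>2)"
    define F where "F = kernel_apply (kernel_pow U P n) f"
    define G where "G k = kernel_apply (kernel_pow (Phi k) (Q k) n) (\<lambda>z. f (k, z))" for k
    have F: "F \<in> L2 U" unfolding F_def by (rule kernel_pow_L2[OF f])
    have "(\<integral>z. (F (k, z))\<^sup>2 \<partial>Phi k)
      \<le> (1 + \<theta>) * ((h k)\<^sup>2 + r * (\<integral>z. (f (k, z) - h k)\<^sup>2 \<partial>Phi k))
        + (1 + 1 / \<theta>) * (\<integral>z. (F (k, z) - G k z)\<^sup>2 \<partial>Phi k)" for k
    proof -
      interpret k: invariant_kernel "Phi k" "Q k" by (rule component_kernel)
      interpret kn: invariant_kernel "Phi k" "kernel_pow (Phi k) (Q k) n" by (rule k.invariant_kernel_pow)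
      define g where "g z = f (k, z) - h k" for z
      define g' where "g' = kernel_apply (kernel_pow (Phi k) (Q k) n) g"
      have fk: "(\<lambda>z. f (k, z)) \<in> L2 (Phi k)" by (rule L2_component[OF f])
      have Fk: "(\<lambda>z. F (k, z)) \<in> L2 (Phi k)" by (rule L2_component[OF F])
      have Gk: "G k \<in> L2 (Phi k)" unfolding G_def by (rule kn.kernel_apply_L2[OF fk])
      have g: "g \<in> L2_0 (Phi k)" unfolding g_def h_def by (rule component_centered_L2_0[OF f])
      have g': "g' \<in> L2_0 (Phi k)" unfolding g'_def by (rule kn.kernel_apply_L2_0[OF g])
      have "AE z in Phi k. G k z = h k + g' z"
        using kn.AE_kernel_integrable[OF L2_integrable[OF k.finite_measure_axioms fk]] AE_space
      proof eventually_elim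
        case (elim z)
        interpret z: prob_space "kernel_pow (Phi k) (Q k) n z" using elim by (intro kn.prob_space_kernel)
        show ?case using elim by (simp add: G_def g'_def g_def[abs_def] kernel_apply_def z.prob_space)
      qed
      hence "(\<integral>z. (G k z)\<^sup>2 \<partial>Phi k) = (\<integral>z. (h k)\<^sup>2 + 2 * h k * g' z + (g' z)\<^sup>2 \<partial>Phi k)"
        using Gk g' by (intro integral_cong_AE)
          (auto simp: L2_def L2_0_def power2_sum algebra_simps elim!: eventually_mono)
      \<comment> \<open>The cross term vanishes because \<open>g'\<close> inherits mean zero from
        \<open>g\<close>.\<close>
      also have "\<dots> = (h k)\<^sup>2 + (\<integral>z. (g' z)\<^sup>2 \<partial>Phi k)"
        using g' by (simp add: L2_0_def L2_def k.prob_space)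
      also have "\<dots> \<le> (h k)\<^sup>2 + r * (\<integral>z. (g z)\<^sup>2 \<partial>Phi k)"
        using gap[OF g] by (simp add: g'_def)
      finally have G_le: "(\<integral>z. (G k z)\<^sup>2 \<partial>Phi k) \<le> (h k)\<^sup>2 + r * (\<integral>z. (f (k, z) - h k)\<^sup>2 \<partial>Phi k)"
        by (simp add: g_def)
      have "(\<integral>z. (F (k, z))\<^sup>2 \<partial>Phi k) \<le> (1 + \<theta>) * (\<integral>z. (G k z)\<^sup>2 \<partial>Phi k)
          + (1 + 1 / \<theta>) * (\<integral>z. (F (k, z) - G k z)\<^sup>2 \<partial>Phi k)"
        using L2_square_sum_le[OF Gk L2_diff[OF Fk Gk] \<theta>] by simp
      moreover have "(1 + \<theta>) * (\<integral>z. (G k z)\<^sup>2 \<partial>Phi k)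
          \<le> (1 + \<theta>) * ((h k)\<^sup>2 + r * (\<integral>z. (f (k, z) - h k)\<^sup>2 \<partial>Phi k))"
        using G_le \<theta> by (intro mult_left_mono) auto
      ultimately show ?thesis by linarith
    qed
    hence "(\<Sum>k\<in>UNIV. w k * (\<integral>z. (F (k, z))\<^sup>2 \<partial>Phi k))
      \<le> (\<Sum>k\<in>UNIV. w k * ((1 + \<theta>) * ((h k)\<^sup>2 + r * (\<integral>z. (f (k, z) - h k)\<^sup>2 \<partial>Phi k))
        + (1 + 1 / \<theta>) * (\<integral>z. (F (k, z) - G k z)\<^sup>2 \<partial>Phi k)))"
      by (rule weighted_sum_mono)
    also have "\<dots> = (1 + \<theta>) * (H + r * within_variance f) + (1 + 1 / \<theta>) * split_error n f"
    proof -
      have "w k * ((1 + \<theta>) * ((h k)\<^sup>2 + r * a) + (1 + 1 / \<theta>) * b)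
        = (1 + \<theta>) * (w k * (h k)\<^sup>2 + r * (w k * a)) + (1 + 1 / \<theta>) * (w k * b)" for k a b
        by (simp add: algebra_simps)
      thus ?thesis
        unfolding H_def within_variance_def split_error_def F_def G_def h_def
        by (simp only: sum.distrib sum_distrib_left[symmetric])
    qed
    also have "(\<Sum>k\<in>UNIV. w k * (\<integral>z. (F (k, z))\<^sup>2 \<partial>Phi k)) = (\<integral>x. (f x)\<^sup>2 \<partial>U) - deficit n f"
      by (simp add: deficit_def F_def[symmetric] L2_mixture[OF F])
    finally have 1: "(\<integral>x. (f x)\<^sup>2 \<partial>U) - deficit n f
      \<le> (1 + \<theta>) * (H + r * within_variance f) + (1 + 1 / \<theta>) * split_error n f" .
    have 2: "(1 + 1 / \<theta>) * split_error n f \<le> (1 + 1 / \<theta>) * (e * deficit n f)"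
      using e(2)[OF f] \<theta> by (intro mult_left_mono) auto
    have N: "(\<integral>x. (f x)\<^sup>2 \<partial>U) = H + within_variance f"
      by (simp add: within_variance_decomp[OF f] H_def h_def)
    have 3: "\<theta> * (H + r * within_variance f) \<le> \<theta> * (H + within_variance f)"
      using \<theta> r within_variance_nonneg[of f] by (intro mult_left_mono) (auto intro: mult_left_le_one_le)
    have "(1 - r) * within_variance f \<le> \<theta> * (\<integral>x. (f x)\<^sup>2 \<partial>U) + C * deficit n f"
      using 1 2 3 unfolding N C_def by (simp add: algebra_simps)
    also have "\<dots> = (1 - r) * (\<eta> * (\<integral>x. (f x)\<^sup>2 \<partial>U) + C / (1 - r) * deficit n f)"
      using r by (simp add: \<theta>_def field_simps)
    finally show ?thesis using r by simp
  qed
  show ?thesis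
    by (intro exI[of _ "C / (1 - r)"] conjI ballI main) (use C r in auto)
qed

text \<open>The first power is \<open>P\<close> followed by \<open>return\<close>;
  \<open>deficit_Suc\<close> at 0 and the almost-everywhere calculus identify its effect with that
  of \<open>P\<close>.\<close>

lemma deficit_1:
  assumes f: "f \<in> L2 U"
  shows "deficit 1 f = (\<integral>x. (f x)\<^sup>2 \<partial>U) - (\<integral>x. (kernel_apply P f x)\<^sup>2 \<partial>U)"
proof -
  define F where "F = kernel_apply (kernel_pow U P 0) f"
  have f_meas: "f \<in> borel_measurable U" and F_meas: "F \<in> borel_measurable U"
    using f kernel_pow_L2[OF f, of 0] by (auto simp: L2_def F_def simp del: kernel_pow.simps)
  have F: "F x = f x" if "x \<in> space U" for x
    unfolding F_def using f_meas that by (rule kernel_pow_apply_0)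
  have "AE x in U. kernel_apply P F x = kernel_apply P f x"
    by (rule AE_kernel_cong[OF _ F_meas f_meas]) (auto intro!: AE_I2 F)
  hence "(\<integral>x. (kernel_apply P F x)\<^sup>2 \<partial>U) = (\<integral>x. (kernel_apply P f x)\<^sup>2 \<partial>U)"
    using f_meas F_meas by (intro integral_cong_AE) (auto elim!: eventually_mono)
  moreover have "(\<integral>x. (F x)\<^sup>2 \<partial>U) = (\<integral>x. (f x)\<^sup>2 \<partial>U)"
    by (rule Bochner_Integration.integral_cong) (simp_all add: F)
  ultimately show ?thesis
    using deficit_Suc[OF f, of 0] by (simp add: deficit_def F_def)
qed

section \<open>Variation between the components\<close>

text \<open>The integral behind \<open>gamma_mat\<close>, taken under \<open>Phi k\<close> instead
  of \<open>Psi k\<close>, and with the component written as a level set of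
  \<open>fst\<close>.\<close>

definition transition_mass :: "'k \<Rightarrow> 'k \<Rightarrow> real" where
  "transition_mass k k' = (\<integral>z. measure (P (k, z)) (fst -` {k'} \<inter> space U) \<partial>Phi k)"

text \<open>Twice the Dirichlet form of the chain on the labels with transition matrix
  \<open>transition_mass\<close> and stationary weights \<open>w\<close>.\<close>

definition energy :: "('k \<Rightarrow> real) \<Rightarrow> real" where
  "energy h = (\<Sum>k\<in>UNIV. w k * (\<Sum>k'\<in>UNIV. transition_mass k k' * (h k' - h k)\<^sup>2))"

text \<open>For a step of \<open>P\<close> from x = (k, z) to y in component k', h k' - h k is the
  sum of h k' - f y, f y - P f(x), P f(x) - Q f(x) and Q f(x) - h k. The mean squares are bounded in
  turn by the variance inside the components, the one-step deficit, the deficit over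
  \<open>c\<close>, and again the variance inside the components. The 4 comes from
  \<open>four_squares\<close>.\<close>

lemma energy_le:
  assumes f: "f \<in> L2 U"
  shows "energy (component_mean f) \<le> 4 * (2 * within_variance f + (1 + 1 / c) * deficit 1 f)"
proof -
  define h where "h = component_mean f"
  define s where "s k' x = measure (P x) (fst -` {k'} \<inter> space U)" for k' x
  define b where "b y = f y - h (fst y)" for y
  define S where "S = kernel_apply P (\<lambda>y. (b y)\<^sup>2)"
  define d where "d k z = kernel_apply P f (k, z) - kernel_apply (Q k) (\<lambda>z. f (k, z)) z" for k z
  define e where "e k z = kernel_apply (Q k) (\<lambda>z. b (k, z)) z" for k z
  have hL2: "(\<lambda>y. h (fst y)) \<in> L2 U"
  proof -
    have [measurable]: "(\<lambda>y. h (fst y)) \<in> borel_measurable U"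
      by (rule measurable_compose[OF fst_measurable]) simp
    have "\<bar>h k\<bar> \<le> Max (range (\<lambda>k. \<bar>h k\<bar>))" for k by simp
    hence "(h k)\<^sup>2 \<le> (Max (range (\<lambda>k. \<bar>h k\<bar>)))\<^sup>2" for k by (intro sqrt_le_D) simp
    thus ?thesis unfolding L2_def
      by (auto intro!: integrable_const_bound[where B="(Max (range (\<lambda>k. \<bar>h k\<bar>)))\<^sup>2"])
  qed
  have b: "b \<in> L2 U" unfolding b_def by (rule L2_diff[OF f hL2])
  have b2: "integrable U (\<lambda>y. (b y)\<^sup>2)" using b by (simp add: L2_def)
  have b_int: "(\<Sum>k\<in>UNIV. w k * (\<integral>z. (b (k, z))\<^sup>2 \<partial>Phi k)) = within_variance f"
    by (simp add: within_variance_def b_def h_def)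
  have [measurable]: "fst -` {k'} \<inter> space U \<in> sets U" for k'
    by (rule measurable_sets[OF fst_measurable]) simp
  have s_meas [measurable]: "s k' \<in> borel_measurable U" for k'
    unfolding s_def by (rule measurable_compose[OF kernel_subprob measurable_measure_subprob_algebra]) simp
  have s_bound: "x \<in> space U \<Longrightarrow> \<bar>s k' x\<bar> \<le> 1" for k' x
    using prob_space.prob_le_1[OF prob_space_kernel] by (simp add: s_def)
  have s_int: "integrable U (s k')" for k'
    by (rule integrable_const_bound[where B=1]) (auto intro!: AE_I2 s_bound)
  have pointwise: "AE z in Phi k. (\<Sum>k'\<in>UNIV. s k' (k, z) * (h k' - h k)\<^sup>2)
      \<le> 4 * (S (k, z) + Var f (k, z) + (d k z)\<^sup>2 + (e k z)\<^sup>2)" for k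
  proof -
    interpret k: invariant_kernel "Phi k" "Q k" by (rule component_kernel)
    have fk: "(\<lambda>z. f (k, z)) \<in> L2 (Phi k)" by (rule L2_component[OF f])
    show ?thesis
      using AE_component[OF AE_L2_kernel[OF f], of k] AE_component[OF AE_L2_kernel[OF b], of k]
        AE_component[OF AE_L2_kernel[OF hL2], of k]
        k.AE_kernel_integrable[OF L2_integrable[OF k.finite_measure_axioms fk]] AE_space
    proof eventually_elim
      case (elim z)
      have kz: "(k, z) \<in> space U" using elim(5) measurable_space[OF Pair_measurable] by auto
      interpret x: prob_space "P (k, z)" by (rule prob_space_kernel[OF kz])
      interpret z: prob_space "Q k z" by (rule k.prob_space_kernel[OF elim(5)])
      define m where "m = kernel_apply P f (k, z)"
      have sp: "space (P (k, z)) = space U" by (rule sets_eq_imp_space_eq[OF sets_kernel_eq[OF kz]])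
      have e_eq: "e k z = kernel_apply (Q k) (\<lambda>z. f (k, z)) z - h k"
        using elim(4) by (simp add: e_def b_def kernel_apply_def z.prob_space)
      have ind: "integrable (P (k, z)) (\<lambda>y. indicator (fst -` {k'} \<inter> space U) y * v)" for k' and v :: real
        by (intro integrable_mult_left integrable_real_indicator)
          (auto simp: sets_kernel_eq[OF kz] x.emeasure_eq_measure)
      have "(\<Sum>k'\<in>UNIV. s k' (k, z) * (h k' - h k)\<^sup>2)
        = (\<integral>y. (\<Sum>k'\<in>UNIV. indicator (fst -` {k'} \<inter> space U) y * (h k' - h k)\<^sup>2) \<partial>P (k, z))"
        by (subst Bochner_Integration.integral_sum) (use ind in \<open>auto simp: s_def sets_kernel_eq[OF kz]\<close>)
      also have "\<dots> = (\<integral>y. (h (fst y) - h k)\<^sup>2 \<partial>P (k, z))"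
      proof (rule Bochner_Integration.integral_cong)
        fix y assume "y \<in> space (P (k, z))"
        hence "indicator (fst -` {k'} \<inter> space U) y * (h k' - h k)\<^sup>2
          = (if k' = fst y then (h (fst y) - h k)\<^sup>2 else 0)" for k'
          by (auto simp: sp)
        thus "(\<Sum>k'\<in>UNIV. indicator (fst -` {k'} \<inter> space U) y * (h k' - h k)\<^sup>2) = (h (fst y) - h k)\<^sup>2"
          by (simp add: sum.delta)
      qed simp
      also have "\<dots> \<le> (\<integral>y. 4 * ((b y)\<^sup>2 + (f y - m)\<^sup>2 + (d k z)\<^sup>2 + (e k z)\<^sup>2) \<partial>P (k, z))"
      proof (rule integral_mono)
        show "integrable (P (k, z)) (\<lambda>y. (h (fst y) - h k)\<^sup>2)"
          using L2_diff[OF elim(3) x.L2_const[of "h k"]] by (simp add: L2_def)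
        show "integrable (P (k, z)) (\<lambda>y. 4 * ((b y)\<^sup>2 + (f y - m)\<^sup>2 + (d k z)\<^sup>2 + (e k z)\<^sup>2))"
          using elim(2) L2_diff[OF elim(1) x.L2_const[of m]] by (simp add: L2_def)
        fix y
        have "h (fst y) - h k = - b y + (f y - m) + d k z + e k z"
          by (simp add: b_def d_def e_eq m_def)
        thus "(h (fst y) - h k)\<^sup>2 \<le> 4 * ((b y)\<^sup>2 + (f y - m)\<^sup>2 + (d k z)\<^sup>2 + (e k z)\<^sup>2)"
          using four_squares[of "- b y" "f y - m" "d k z" "e k z"] by simp
      qed
      also have "\<dots> = 4 * (S (k, z) + (\<integral>y. (f y - m)\<^sup>2 \<partial>P (k, z)) + (d k z)\<^sup>2 + (e k z)\<^sup>2)"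
        using elim(2) L2_diff[OF elim(1) x.L2_const[of m]]
        by (simp add: L2_def S_def kernel_apply_def x.prob_space)
      also have "(\<integral>y. (f y - m)\<^sup>2 \<partial>P (k, z)) = Var f (k, z)"
        unfolding m_def Var_def kernel_apply_def
        using elim(1) L2_integrable[OF x.finite_measure_axioms elim(1)]
        by (intro x.variance_eq) (auto simp: L2_def)
      finally show ?case .
    qed
  qed
  have "(\<Sum>k'\<in>UNIV. transition_mass k k' * (h k' - h k)\<^sup>2)
    \<le> 4 * ((\<integral>z. S (k, z) \<partial>Phi k) + (\<integral>z. Var f (k, z) \<partial>Phi k) + (\<integral>z. (d k z)\<^sup>2 \<partial>Phi k) + (\<integral>z. (b (k, z))\<^sup>2 \<partial>Phi k))" for k
  proof -
    interpret k: invariant_kernel "Phi k" "Q k" by (rule component_kernel)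
    have bk: "(\<lambda>z. b (k, z)) \<in> L2 (Phi k)" by (rule L2_component[OF b])
    have e: "e k \<in> L2 (Phi k)" unfolding e_def by (rule k.kernel_apply_L2[OF bk])
    have d: "d k \<in> L2 (Phi k)"
      unfolding d_def
      by (rule L2_diff[OF L2_component[OF kernel_apply_L2[OF f]] k.kernel_apply_L2[OF L2_component[OF f]]])
    have i: "integrable (Phi k) (\<lambda>z. s k' (k, z))" "integrable (Phi k) (\<lambda>z. S (k, z))"
      "integrable (Phi k) (\<lambda>z. Var f (k, z))" "integrable (Phi k) (\<lambda>z. (d k z)\<^sup>2)" "integrable (Phi k) (\<lambda>z. (e k z)\<^sup>2)" for k'
      using integrable_component[OF s_int] integrable_component[OF Var_integral(1)[OF f]]
        integrable_component[OF kernel_apply_integral(1)[OF b2]] e d by (auto simp: S_def L2_def)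
    have "(\<Sum>k'\<in>UNIV. transition_mass k k' * (h k' - h k)\<^sup>2)
      = (\<integral>z. (\<Sum>k'\<in>UNIV. s k' (k, z) * (h k' - h k)\<^sup>2) \<partial>Phi k)"
      using i by (subst Bochner_Integration.integral_sum) (auto simp: transition_mass_def s_def)
    also have "\<dots> \<le> (\<integral>z. 4 * (S (k, z) + Var f (k, z) + (d k z)\<^sup>2 + (e k z)\<^sup>2) \<partial>Phi k)"
      by (rule integral_mono_AE[OF _ _ pointwise]) (use i in auto)
    also have "\<dots> = 4 * ((\<integral>z. S (k, z) \<partial>Phi k) + (\<integral>z. Var f (k, z) \<partial>Phi k) + (\<integral>z. (d k z)\<^sup>2 \<partial>Phi k) + (\<integral>z. (e k z)\<^sup>2 \<partial>Phi k))"
      using i by simp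
    also have "(\<integral>z. (e k z)\<^sup>2 \<partial>Phi k) \<le> (\<integral>z. (b (k, z))\<^sup>2 \<partial>Phi k)"
      unfolding e_def by (rule k.kernel_apply_contraction[OF bk])
    finally show ?thesis by simp
  qed
  hence "energy h \<le> (\<Sum>k\<in>UNIV. w k * (4 * ((\<integral>z. S (k, z) \<partial>Phi k) + (\<integral>z. Var f (k, z) \<partial>Phi k)
      + (\<integral>z. (d k z)\<^sup>2 \<partial>Phi k) + (\<integral>z. (b (k, z))\<^sup>2 \<partial>Phi k))))"
    unfolding energy_def by (rule weighted_sum_mono)
  also have "\<dots> = 4 * ((\<Sum>k\<in>UNIV. w k * (\<integral>z. S (k, z) \<partial>Phi k)) + (\<Sum>k\<in>UNIV. w k * (\<integral>z. Var f (k, z) \<partial>Phi k))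
      + (\<Sum>k\<in>UNIV. w k * (\<integral>z. (d k z)\<^sup>2 \<partial>Phi k)) + within_variance f)"
    by (simp add: b_int[symmetric] sum_distrib_left sum.distrib algebra_simps)
  \<comment> \<open>Invariance: the target of a step started from \<open>U\<close> has law
    \<open>U\<close> again.\<close>
  also have "(\<Sum>k\<in>UNIV. w k * (\<integral>z. S (k, z) \<partial>Phi k)) = within_variance f"
    using kernel_apply_integral[OF b2] unfolding S_def
    by (subst integral_mixture[symmetric]) (auto simp: integral_mixture[OF b2] b_int)
  also have "(\<Sum>k\<in>UNIV. w k * (\<integral>z. Var f (k, z) \<partial>Phi k)) = deficit 1 f"
    using Var_integral[OF f] unfolding deficit_1[OF f] by (simp add: integral_mixture[symmetric])
  also have "(\<Sum>k\<in>UNIV. w k * (\<integral>z. (d k z)\<^sup>2 \<partial>Phi k)) \<le> deficit 1 f / c"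
    using component_deviation_integral[OF f] unfolding d_def deficit_1[OF f] .
  finally show ?thesis by (simp add: h_def algebra_simps)
qed


text \<open>The hypothesis \<open>irr\<close> is a quantitative form of irreducibility of the transition graph on the components.\<close>

lemma variance_of_means_le:
  assumes irr: "\<And>i j h v. (\<And>i j. 0 < transition_mass i j \<Longrightarrow> (h i - h j)\<^sup>2 \<le> v) \<Longrightarrow> (h i - h j)\<^sup>2 \<le> B * v"
    and B: "0 \<le> (B :: real)"
  shows "\<exists>C\<ge>0. \<forall>h. (\<Sum>k\<in>UNIV. w k * h k) = 0 \<longrightarrow> (\<Sum>k\<in>UNIV. w k * (h k)\<^sup>2) \<le> C * energy h"
proof -
  \<comment> \<open>Collects the positive edge weights; the extra 1 keeps the set nonempty. Their
    minimum \<open>m\<close> turns a small energy into a small difference along every edge.\<close>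
  define W where "W = insert 1 {w k * transition_mass k k' | k k'. 0 < transition_mass k k'}"
  have "W \<subseteq> insert 1 ((\<lambda>(k, k'). w k * transition_mass k k') ` UNIV)" by (auto simp: W_def)
  hence fin: "finite W" by (rule finite_subset) simp
  define m where "m = Min W"
  have "m \<in> W" unfolding m_def using fin by (intro Min_in) (auto simp: W_def)
  hence m: "0 < m" using w_pos by (auto simp: W_def)
  have mass: "0 \<le> transition_mass k k'" for k k' by (simp add: transition_mass_def)
  have "(\<Sum>k\<in>UNIV. w k * (h k)\<^sup>2) \<le> B / m * energy h" if h: "(\<Sum>k\<in>UNIV. w k * h k) = 0" for h
  proof -
    have step: "(h i - h j)\<^sup>2 \<le> energy h / m" if ij: "0 < transition_mass i j" for i j
    proof -
      have "m \<le> w i * transition_mass i j"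
        unfolding m_def using fin ij by (intro Min_le) (auto simp: W_def)
      hence "m * (h j - h i)\<^sup>2 \<le> w i * (transition_mass i j * (h j - h i)\<^sup>2)"
        using mult_right_mono[of m "w i * transition_mass i j" "(h j - h i)\<^sup>2"] by (simp add: mult_ac)
      also have "\<dots> \<le> w i * (\<Sum>k'\<in>UNIV. transition_mass i k' * (h k' - h i)\<^sup>2)"
        using w_pos[of i] mass by (intro mult_left_mono member_le_sum) auto
      also have "\<dots> \<le> energy h"
        unfolding energy_def using mass w_pos
        by (intro member_le_sum[where f="\<lambda>i. w i * (\<Sum>k'\<in>UNIV. transition_mass i k' * (h k' - h i)\<^sup>2)"])
          (auto intro!: mult_nonneg_nonneg sum_nonneg simp: less_imp_le)
      finally show ?thesis using m by (simp add: field_simps power2_commute)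
    qed
    have le: "(h i - h j)\<^sup>2 \<le> B * (energy h / m)" for i j
      by (rule irr[OF step])
    \<comment> \<open>The weighted sum over pairs is twice the variance of \<open>h\<close>, and the
      mean of \<open>h\<close> is zero.\<close>
    have "2 * (\<Sum>k\<in>UNIV. w k * (h k)\<^sup>2) = (\<Sum>i\<in>UNIV. w i * (\<Sum>j\<in>UNIV. w j * (h i - h j)\<^sup>2))"
    proof -
      have "(\<Sum>j\<in>UNIV. w j * (h i - h j)\<^sup>2) = (h i)\<^sup>2 + (\<Sum>k\<in>UNIV. w k * (h k)\<^sup>2)" for i
      proof -
        have "(\<Sum>j\<in>UNIV. w j * (h i - h j)\<^sup>2)
          = (\<Sum>j\<in>UNIV. w j * (h i)\<^sup>2 - 2 * h i * (w j * h j) + w j * (h j)\<^sup>2)"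
          by (simp add: power2_eq_square algebra_simps)
        also have "\<dots> = (\<Sum>j\<in>UNIV. w j) * (h i)\<^sup>2 - 2 * h i * (\<Sum>j\<in>UNIV. w j * h j) + (\<Sum>j\<in>UNIV. w j * (h j)\<^sup>2)"
          by (simp only: sum.distrib sum_subtractf sum_distrib_left[symmetric] sum_distrib_right[symmetric])
        finally show ?thesis by (simp add: h sum_w)
      qed
      thus ?thesis
        by (simp add: distrib_left sum.distrib sum_distrib_right[symmetric] sum_w)
    qed
    also have "\<dots> \<le> (\<Sum>i\<in>UNIV. w i * (\<Sum>j\<in>UNIV. w j * (B * (energy h / m))))"
      by (intro weighted_sum_mono le)
    also have "\<dots> = B * (energy h / m)" by (simp only: sum_distrib_right[symmetric] sum_w mult_1)
    finally have "2 * (\<Sum>k\<in>UNIV. w k * (h k)\<^sup>2) \<le> B * (energy h / m)" .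
    moreover have "0 \<le> (\<Sum>k\<in>UNIV. w k * (h k)\<^sup>2)" by (rule mean_sq_nonneg)
    ultimately show ?thesis by simp
  qed
  thus ?thesis using B m by (intro exI[of _ "B / m"]) auto
qed

section \<open>The operator norm bound on a mixture\<close>

theorem op_norm_kernel_pow_less_1:
  assumes n: "0 < n"
    and gap: "\<And>k. op_norm (Phi k) (kernel_pow (Phi k) (Q k) n) < 1"
    and irr: "\<And>i j h v. (\<And>i j. 0 < transition_mass i j \<Longrightarrow> (h i - h j)\<^sup>2 \<le> v) \<Longrightarrow> (h i - h j)\<^sup>2 \<le> B * v"
    and B: "0 \<le> (B :: real)"
  shows "op_norm U (kernel_pow U P n) < 1"
proof -
  have "\<exists>r. \<forall>k. 0 < r k \<and> r k < 1 \<and> (\<forall>g\<in>L2_0 (Phi k).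
      (\<integral>z. (kernel_apply (kernel_pow (Phi k) (Q k) n) g z)\<^sup>2 \<partial>Phi k) \<le> r k * (\<integral>z. (g z)\<^sup>2 \<partial>Phi k))"
    (is "\<exists>r. \<forall>k. ?P k (r k)")
  proof (rule choice, rule allI)
    fix k
    show "\<exists>r. ?P k r"
      using op_norm_less_1D[OF invariant_kernel.invariant_kernel_pow[OF component_kernel] gap[of k]] by metis
  qed
  then obtain r where r: "\<And>k. 0 < r k" "\<And>k. r k < 1"
    "\<And>k g. g \<in> L2_0 (Phi k) \<Longrightarrow>
      (\<integral>z. (kernel_apply (kernel_pow (Phi k) (Q k) n) g z)\<^sup>2 \<partial>Phi k) \<le> r k * (\<integral>z. (g z)\<^sup>2 \<partial>Phi k)"
    by blast
  define R where "R = Max (range r)"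
  have "R \<in> range r" unfolding R_def by (intro Max_in) auto
  hence R: "0 \<le> R" "R < 1" using r by (auto simp: less_imp_le)
  have gapR: "(\<integral>z. (kernel_apply (kernel_pow (Phi k) (Q k) n) g z)\<^sup>2 \<partial>Phi k) \<le> R * (\<integral>z. (g z)\<^sup>2 \<partial>Phi k)"
    if "g \<in> L2_0 (Phi k)" for k g
    using r(3)[OF that] mult_right_mono[of "r k" R "\<integral>z. (g z)\<^sup>2 \<partial>Phi k"] by (force simp: R_def)
  obtain A where A: "0 \<le> A" "\<And>h. (\<Sum>k\<in>UNIV. w k * h k) = 0 \<Longrightarrow> (\<Sum>k\<in>UNIV. w k * (h k)\<^sup>2) \<le> A * energy h"
    using variance_of_means_le[OF irr B] by metis
  \<comment> \<open>Makes \<open>(8 * A + 1) * \<eta>\<close> equal to one half, so that half of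
    ||f||^2 can be absorbed. The 8 is the 4 * 2 of \<open>energy_le\<close>; the 1 counts the
    variance inside the components itself.\<close>
  define \<eta> where "\<eta> = 1 / (2 * (8 * A + 1))"
  have \<eta>: "0 < \<eta>" using A by (simp add: \<eta>_def)
  obtain C where C: "0 \<le> C"
    "\<And>f. f \<in> L2 U \<Longrightarrow> within_variance f \<le> \<eta> * (\<integral>x. (f x)\<^sup>2 \<partial>U) + C * deficit n f"
    using within_variance_le[OF R gapR \<eta>] by metis
  \<comment> \<open>The factor 2 pays for the absorbed half, and the summand 1 keeps
    \<open>D\<close> positive.\<close>
  define D where "D = 2 * ((8 * A + 1) * C + A * (4 * (1 + 1 / c))) + 1"
  have "0 \<le> (8 * A + 1) * C + A * (4 * (1 + 1 / c))"
    using A C c_pos by (intro add_nonneg_nonneg mult_nonneg_nonneg) auto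
  hence D: "1 \<le> D" by (simp add: D_def)
  show ?thesis
  proof (rule op_norm_less_1I)
    show "1 - 1 / D < 1" using D by simp
    fix f assume f0: "f \<in> L2_0 U"
    hence f: "f \<in> L2 U" by (simp add: L2_0_def)
    have "(\<Sum>k\<in>UNIV. w k * component_mean f k) = 0"
      using f0 integral_mixture[of f] by (simp add: L2_0_def component_mean_def)
    hence "(\<Sum>k\<in>UNIV. w k * (component_mean f k)\<^sup>2) \<le> A * energy (component_mean f)" by (rule A)
    also have "\<dots> \<le> A * (4 * (2 * within_variance f + (1 + 1 / c) * deficit 1 f))"
      using energy_le[OF f] A by (intro mult_left_mono) auto
    \<comment> \<open>The energy involves one step and the gap \<open>n\<close> steps;
      \<open>0 < n\<close> makes the one-step loss the smaller one.\<close>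
    also have "\<dots> \<le> A * (4 * (2 * within_variance f + (1 + 1 / c) * deficit n f))"
      using deficit_mono[OF f, of 1 n] n A c_pos by (intro mult_left_mono add_left_mono) auto
    finally have "(\<integral>x. (f x)\<^sup>2 \<partial>U)
      \<le> (8 * A + 1) * within_variance f + A * (4 * (1 + 1 / c)) * deficit n f"
      by (simp add: within_variance_decomp[OF f] algebra_simps)
    also have "(8 * A + 1) * within_variance f \<le> (8 * A + 1) * (\<eta> * (\<integral>x. (f x)\<^sup>2 \<partial>U) + C * deficit n f)"
      using C(2)[OF f] A by (intro mult_left_mono) auto
    also have "\<dots> = (\<integral>x. (f x)\<^sup>2 \<partial>U) / 2 + (8 * A + 1) * C * deficit n f"
    proof -
      have "(8 * A + 1) * \<eta> = 1 / 2" using A by (simp add: \<eta>_def)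
      thus ?thesis by (simp add: distrib_left mult.assoc[symmetric])
    qed
    finally have "(\<integral>x. (f x)\<^sup>2 \<partial>U)
      \<le> 2 * ((8 * A + 1) * C * deficit n f + A * (4 * (1 + 1 / c)) * deficit n f)" by simp
    also have "\<dots> = (D - 1) * deficit n f" by (simp add: D_def distrib_right)
    also have "\<dots> \<le> D * deficit n f" using deficit_nonneg[OF f] by (intro mult_right_mono) auto
    finally have "(\<integral>x. (f x)\<^sup>2 \<partial>U) / D \<le> deficit n f" using D by (simp add: field_simps)
    thus "(\<integral>x. (kernel_apply (kernel_pow U P n) f x)\<^sup>2 \<partial>U) \<le> (1 - 1 / D) * (\<integral>x. (f x)\<^sup>2 \<partial>U)"
      by (simp add: deficit_def algebra_simps)
  qed
qed

end

text \<open>A positive entry of the \<open>n\<close>-th power yields a path of \<open>n\<close>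
  edges from \<open>i\<close> to \<open>j\<close>. Each added edge costs a factor 2 on both terms,
  and 2 * 4^n + 2 <= 4 * 4^n. The constant is crude, but only its finiteness matters.\<close>

lemma mat_pow_chain:
  fixes h :: "'k::finite \<Rightarrow> real"
  assumes step: "\<And>i j. 0 < G i j \<Longrightarrow> (h i - h j)\<^sup>2 \<le> v" and "0 < mat_pow G n i j" and v: "0 \<le> v"
  shows "(h i - h j)\<^sup>2 \<le> 4 ^ n * v"
  using assms(2)
proof (induction n arbitrary: j)
  case 0
  thus ?case using v by (simp split: if_splits)
next
  case (Suc n)
  have "(\<Sum>l\<in>UNIV. mat_pow G n i l * G l j) \<noteq> 0" using Suc.prems unfolding mat_pow.simps by (rule gr_implies_not0)
  then obtain l where "mat_pow G n i l * G l j \<noteq> 0" by (meson sum.neutral)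
  hence l: "0 < mat_pow G n i l" "0 < G l j" by simp_all
  have "(h i - h j)\<^sup>2 \<le> 2 * (h i - h l)\<^sup>2 + 2 * (h l - h j)\<^sup>2"
    using sum_squares_bound[of "h i - h l" "h l - h j"] by (simp add: power2_eq_square algebra_simps)
  also have "\<dots> \<le> 2 * (4 ^ n * v) + 2 * v" using Suc.IH[OF l(1)] step[OF l(2)] by simp
  finally have "(h i - h j)\<^sup>2 \<le> 2 * (4 ^ n * v) + 2 * v" .
  moreover have "v \<le> 4 ^ n * v" using v mult_right_mono[of 1 "4 ^ n" v] by simp
  ultimately show ?case by simp
qed

section \<open>The disjoint union of finite measure spaces\<close>

locale nonzero_finite_measures =
  fixes Psi :: "'k::finite \<Rightarrow> 'z measure"
  assumes finite_component: "finite_measure (Psi k)"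
    and nonzero: "emeasure (Psi k) (space (Psi k)) \<noteq> 0"
begin

definition total :: real where "total = (\<Sum>k\<in>UNIV. measure (Psi k) (space (Psi k)))"

definition weight :: "'k \<Rightarrow> real" where "weight k = measure (Psi k) (space (Psi k)) / total"

lemma mass: "emeasure (Psi k) (space (Psi k)) = ennreal (measure (Psi k) (space (Psi k)))"
  by (rule finite_measure.emeasure_eq_measure[OF finite_component])

lemma mass_pos: "0 < measure (Psi k) (space (Psi k))"
  using nonzero[of k] by (simp add: mass less_le)

lemma total_pos: "0 < total"
  unfolding total_def using mass_pos by (intro sum_pos) auto

lemma total_emeasure: "(\<Sum>k\<in>UNIV. emeasure (Psi k) (space (Psi k))) = ennreal total"
  by (simp add: mass total_def)

lemma weight_pos: "0 < weight k"
  using mass_pos total_pos by (simp add: weight_def)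

lemma sets_normalize [simp, measurable_cong]: "sets (normalize_measure (Psi k)) = sets (Psi k)"
  by (simp add: normalize_measure_def)

lemma space_normalize [simp]: "space (normalize_measure (Psi k)) = space (Psi k)"
  by (rule sets_eq_imp_space_eq) simp

lemma normalize_eq: "normalize_measure (Psi k) = scale_measure (ennreal (1 / measure (Psi k) (space (Psi k)))) (Psi k)"
  using mass_pos[of k] by (simp add: normalize_measure_def mass divide_ennreal flip: ennreal_1)

lemma prob_normalize: "prob_space (normalize_measure (Psi k))"
proof
  show "emeasure (normalize_measure (Psi k)) (space (normalize_measure (Psi k))) = 1"
    using mass_pos[of k] by (simp add: normalize_eq space_scale_measure mass ennreal_mult'[symmetric])
qed

lemma nn_integral_normalize:
  assumes "f \<in> borel_measurable (Psi k)"
  shows "ennreal (weight k) * (\<integral>\<^sup>+z. f z \<partial>normalize_measure (Psi k)) = (\<integral>\<^sup>+z. f z \<partial>Psi k) / ennreal total"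
proof -
  have "ennreal (weight k) * (\<integral>\<^sup>+z. f z \<partial>normalize_measure (Psi k))
    = ennreal (weight k * (1 / measure (Psi k) (space (Psi k)))) * (\<integral>\<^sup>+z. f z \<partial>Psi k)"
    unfolding normalize_eq nn_integral_scale_measure[OF assms] ennreal_mult'[OF less_imp_le[OF weight_pos]]
    by (simp only: mult.assoc)
  also have "weight k * (1 / measure (Psi k) (space (Psi k))) = 1 / total"
    using mass_pos[of k] by (simp add: weight_def)
  finally show ?thesis
    using total_pos by (simp add: divide_ennreal_def inverse_ennreal inverse_eq_divide mult.commute)
qed

lemma space_union: "space (union_measure Psi) = (SIGMA k:UNIV. space (Psi k))"
  unfolding union_measure_def
  by (rule space_measure_of) (auto dest: sets.sets_into_space)

lemma sets_union: "sets (union_measure Psi) = sets (union_space Psi)"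
proof -
  have "{{k} \<times> A |k A. A \<in> sets (Psi k)} \<subseteq> Pow (SIGMA k:UNIV. space (Psi k))"
    by (auto dest: sets.sets_into_space)
  thus ?thesis unfolding union_measure_def union_space_def by (simp add: sets_measure_of)
qed

lemma times_in_sets_union [measurable]: "A \<in> sets (Psi k) \<Longrightarrow> {k} \<times> A \<in> sets (union_measure Psi)"
  unfolding union_measure_def
  by (subst sets_measure_of) (auto dest: sets.sets_into_space)

lemma Pair_measurable_union [measurable]: "Pair k \<in> Psi k \<rightarrow>\<^sub>M union_measure Psi"
  unfolding union_measure_def
proof (rule measurable_measure_of)
  show "{{k} \<times> A |k A. A \<in> sets (Psi k)} \<subseteq> Pow (SIGMA k:UNIV. space (Psi k))"
    by (auto dest: sets.sets_into_space)
  fix B assume "B \<in> {{k} \<times> A |k A. A \<in> sets (Psi k)}"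
  then obtain k' A where B: "B = {k'} \<times> A" "A \<in> sets (Psi k')" by auto
  have "Pair k -` B \<inter> space (Psi k) = (if k = k' then A else {})"
    using B by (auto dest: sets.sets_into_space)
  thus "Pair k -` B \<inter> space (Psi k) \<in> sets (Psi k)" using B by auto
qed auto

lemma fst_vimage: "fst -` {k} \<inter> space (union_measure Psi) = {k} \<times> space (Psi k)"
  by (auto simp: space_union)

lemma fst_measurable_union: "fst \<in> union_measure Psi \<rightarrow>\<^sub>M count_space UNIV"
proof (rule measurableI)
  fix A :: "'k set"
  have "fst -` A \<inter> space (union_measure Psi) = (\<Union>k\<in>A. {k} \<times> space (Psi k))"
    by (auto simp: space_union)
  also have "\<dots> \<in> sets (union_measure Psi)"
    by (intro sets.finite_UN) (auto intro: finite_subset)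
  finally show "fst -` A \<inter> space (union_measure Psi) \<in> sets (union_measure Psi)" .
qed simp

text \<open>\<open>measure_of\<close> takes the prescribed values only if they form a countably
  additive set function; this is checked component by component on preimages under
  \<open>Pair k\<close>.\<close>

lemma emeasure_union:
  assumes B: "B \<in> sets (union_measure Psi)"
  shows "emeasure (union_measure Psi) B
    = (\<Sum>k\<in>UNIV. emeasure (Psi k) (Pair k -` B \<inter> space (Psi k))) / ennreal total"
proof -
  have "emeasure (union_measure Psi) B = (\<Sum>k\<in>UNIV. emeasure (Psi k) (Pair k -` B \<inter> space (Psi k)))
             / (\<Sum>k\<in>UNIV. emeasure (Psi k) (space (Psi k)))"
  proof (rule emeasure_measure_of[OF union_measure_def _ _ _ B])
    show "{{k} \<times> A |k A. A \<in> sets (Psi k)} \<subseteq> Pow (SIGMA k:UNIV. space (Psi k))"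
      by (auto dest: sets.sets_into_space)
    show "positive (sets (union_measure Psi)) (\<lambda>B. (\<Sum>k\<in>UNIV. emeasure (Psi k) (Pair k -` B \<inter> space (Psi k)))
             / (\<Sum>k\<in>UNIV. emeasure (Psi k) (space (Psi k))))"
      by (simp add: positive_def)
    show "countably_additive (sets (union_measure Psi)) (\<lambda>B. (\<Sum>k\<in>UNIV. emeasure (Psi k) (Pair k -` B \<inter> space (Psi k)))
             / (\<Sum>k\<in>UNIV. emeasure (Psi k) (space (Psi k))))"
    proof (rule countably_additiveI)
      fix A :: "nat \<Rightarrow> ('k \<times> 'z) set"
      assume A: "range A \<subseteq> sets (union_measure Psi)" "disjoint_family A"
      have "(\<Sum>i. emeasure (Psi k) (Pair k -` A i \<inter> space (Psi k)))
        = emeasure (Psi k) (\<Union>i. Pair k -` A i \<inter> space (Psi k))" for k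
      proof (rule suminf_emeasure)
        show "range (\<lambda>i. Pair k -` A i \<inter> space (Psi k)) \<subseteq> sets (Psi k)"
          using A measurable_sets[OF Pair_measurable_union] by auto
        show "disjoint_family (\<lambda>i. Pair k -` A i \<inter> space (Psi k))"
          using A unfolding disjoint_family_on_def by auto
      qed
      moreover have "(\<Union>i. Pair k -` A i \<inter> space (Psi k)) = Pair k -` \<Union> (range A) \<inter> space (Psi k)" for k
        by auto
      ultimately show "(\<Sum>i. (\<Sum>k\<in>UNIV. emeasure (Psi k) (Pair k -` A i \<inter> space (Psi k)))
             / (\<Sum>k\<in>UNIV. emeasure (Psi k) (space (Psi k))))
        = (\<Sum>k\<in>UNIV. emeasure (Psi k) (Pair k -` \<Union> (range A) \<inter> space (Psi k)))
             / (\<Sum>k\<in>UNIV. emeasure (Psi k) (space (Psi k)))"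
        by (simp add: divide_ennreal_def suminf_sum)
    qed
  qed
  thus ?thesis by (simp add: total_emeasure)
qed

lemma nn_integral_union:
  assumes "f \<in> borel_measurable (union_measure Psi)"
  shows "(\<integral>\<^sup>+x. f x \<partial>union_measure Psi) = (\<Sum>k\<in>UNIV. \<integral>\<^sup>+z. f (k, z) \<partial>Psi k) / ennreal total"
  using assms
proof (induction rule: borel_measurable_induct)
  case (cong f g)
  have "(k, z) \<in> space (union_measure Psi)" if "z \<in> space (Psi k)" for k z
    using that by (simp add: space_union)
  with cong show ?case by (simp cong: nn_integral_cong)
next
  case (set A)
  have "(\<integral>\<^sup>+z. indicator A (k, z) \<partial>Psi k) = emeasure (Psi k) (Pair k -` A \<inter> space (Psi k))" for k
  proof -
    have "(\<integral>\<^sup>+z. indicator A (k, z) \<partial>Psi k) = (\<integral>\<^sup>+z. indicator (Pair k -` A \<inter> space (Psi k)) z \<partial>Psi k)"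
      by (rule nn_integral_cong) (simp add: indicator_def)
    thus ?thesis using measurable_sets[OF Pair_measurable_union set] by simp
  qed
  with set show ?case by (simp add: emeasure_union)
next
  case (mult f c)
  thus ?case
    using measurable_compose[OF Pair_measurable_union]
    by (simp add: nn_integral_cmult sum_distrib_left[symmetric] ennreal_times_divide)
next
  case (add f g)
  thus ?case
    using measurable_compose[OF Pair_measurable_union]
    by (simp add: nn_integral_add sum.distrib divide_ennreal_def distrib_right)
next
  case (seq F)
  have "(\<integral>\<^sup>+z. (SUP i. F i (k, z)) \<partial>Psi k) = (SUP i. \<integral>\<^sup>+z. F i (k, z) \<partial>Psi k)" for k
    using seq measurable_compose[OF Pair_measurable_union]
    by (intro nn_integral_monotone_convergence_SUP) (auto simp: incseq_def le_fun_def)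
  moreover have "incseq (\<lambda>i. \<integral>\<^sup>+z. F i (k, z) \<partial>Psi k)" for k
    using seq by (auto simp: incseq_def le_fun_def intro!: nn_integral_mono)
  ultimately have "(\<Sum>k\<in>UNIV. \<integral>\<^sup>+z. (SUP i. F i (k, z)) \<partial>Psi k) = (SUP i. \<Sum>k\<in>UNIV. \<integral>\<^sup>+z. F i (k, z) \<partial>Psi k)"
    by (simp add: ennreal_SUP_sum[symmetric])
  moreover have "(\<integral>\<^sup>+x. (SUP i. F i x) \<partial>union_measure Psi) = (SUP i. \<integral>\<^sup>+x. F i x \<partial>union_measure Psi)"
    using seq by (intro nn_integral_monotone_convergence_SUP) auto
  ultimately show ?case
    using seq by (simp add: SUP_divide_ennreal SUP_apply image_comp)
qed

lemma mixture_union: "mixture weight (\<lambda>k. normalize_measure (Psi k)) (union_measure Psi)"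
proof (rule mixture.intro)
  show "0 < weight k" for k by (rule weight_pos)
  show "prob_space (normalize_measure (Psi k))" for k by (rule prob_normalize)
  show "Pair k \<in> normalize_measure (Psi k) \<rightarrow>\<^sub>M union_measure Psi" for k
    using Pair_measurable_union by (simp cong: measurable_cong_sets)
  show "fst \<in> union_measure Psi \<rightarrow>\<^sub>M count_space UNIV" by (rule fst_measurable_union)
  fix f :: "'k \<times> 'z \<Rightarrow> ennreal" assume f: "f \<in> borel_measurable (union_measure Psi)"
  show "(\<integral>\<^sup>+x. f x \<partial>union_measure Psi)
    = (\<Sum>k\<in>UNIV. ennreal (weight k) * (\<integral>\<^sup>+z. f (k, z) \<partial>normalize_measure (Psi k)))"
    using measurable_compose[OF Pair_measurable_union f]
    by (simp add: nn_integral_union[OF f] nn_integral_normalize divide_ennreal_def sum_distrib_right)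
qed

lemma prob_space_union: "prob_space (union_measure Psi)"
proof
  have "emeasure (union_measure Psi) (space (union_measure Psi))
      = (\<integral>\<^sup>+x. 1 \<partial>union_measure Psi)" by simp
  also have "\<dots> = ennreal total / ennreal total"
    by (subst nn_integral_union) (simp_all add: total_emeasure)
  also have "\<dots> = 1" using total_pos by (simp add: divide_ennreal)
  finally show "emeasure (union_measure Psi) (space (union_measure Psi)) = 1" .
qed

text \<open>Carries the positivity expressed by \<open>gamma_mat\<close> from \<open>Psi k\<close>
  to its normalization.\<close>

lemma integral_normalize_pos:
  fixes f :: "'z \<Rightarrow> real"
  assumes f: "f \<in> borel_measurable (Psi k)" "\<And>z. 0 \<le> f z" and "0 < (\<integral>z. f z \<partial>Psi k)"
  shows "0 < (\<integral>z. f z \<partial>normalize_measure (Psi k))"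
proof -
  \<comment> \<open>A positive integral forces integrability, the default value being 0.\<close>
  have i: "integrable (Psi k) f" using assms(3) not_integrable_integral_eq by fastforce
  have "(\<integral>\<^sup>+z. ennreal (f z) \<partial>normalize_measure (Psi k))
    = ennreal (1 / measure (Psi k) (space (Psi k))) * ennreal (\<integral>z. f z \<partial>Psi k)"
    using f i by (simp add: normalize_eq nn_integral_scale_measure nn_integral_eq_integral)
  also have "\<dots> = ennreal ((\<integral>z. f z \<partial>Psi k) / measure (Psi k) (space (Psi k)))"
    using mass_pos[of k] assms(3) by (simp add: ennreal_mult'[symmetric])
  finally have "(\<integral>\<^sup>+z. ennreal (f z) \<partial>normalize_measure (Psi k))
    = ennreal ((\<integral>z. f z \<partial>Psi k) / measure (Psi k) (space (Psi k)))" .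
  hence "(\<integral>z. f z \<partial>normalize_measure (Psi k)) = (\<integral>z. f z \<partial>Psi k) / measure (Psi k) (space (Psi k))"
    using f assms(3) mass_pos[of k]
    by (subst integral_eq_nn_integral) auto
  thus ?thesis using assms(3) mass_pos[of k] by simp
qed

text \<open>The hypothesis concerns sets inside one component only. A general \<open>B\<close>
  contains {k} times its section at \<open>k\<close>, so \<open>c\<close> times the image of
  \<open>Pk z\<close> under \<open>Pair k\<close> lies below \<open>P (k, z)\<close> as a measure,
  and integrals of nonnegative functions compare.\<close>

lemma domination_nn_integral:
  assumes Pk: "Pk \<in> Psi k \<rightarrow>\<^sub>M prob_algebra (Psi k)" and P: "P \<in> union_measure Psi \<rightarrow>\<^sub>M prob_algebra (union_measure Psi)"
    and c: "0 < c" and z: "z \<in> space (Psi k)"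
    and dom: "\<And>A. A \<in> sets (Psi k) \<Longrightarrow> c * measure (Pk z) A \<le> measure (P (k, z)) ({k} \<times> A)"
    and g: "g \<in> borel_measurable (union_measure Psi)"
  shows "ennreal c * (\<integral>\<^sup>+z'. g (k, z') \<partial>Pk z) \<le> (\<integral>\<^sup>+x. g x \<partial>P (k, z))"
proof -
  have Q: "prob_space (Pk z)" "sets (Pk z) = sets (Psi k)"
    using measurable_space[OF Pk z] by (auto simp: space_prob_algebra)
  have kz: "(k, z) \<in> space (union_measure Psi)" using z by (simp add: space_union)
  have R: "prob_space (P (k, z))" "sets (P (k, z)) = sets (union_measure Psi)"
    using measurable_space[OF P kz] by (auto simp: space_prob_algebra)
  interpret Q: prob_space "Pk z" by (rule Q)
  interpret R: prob_space "P (k, z)" by (rule R)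
  have pair: "Pair k \<in> Pk z \<rightarrow>\<^sub>M union_measure Psi"
    using Pair_measurable_union by (simp cong: measurable_cong_sets add: Q)
  define D where "D = scale_measure (ennreal c) (distr (Pk z) (union_measure Psi) (Pair k))"
  have sets: "sets D = sets (P (k, z))" by (simp add: D_def R)
  have "D \<le> P (k, z)"
  proof (rule le_measure[THEN iffD2, OF sets])
    show "\<forall>B\<in>sets D. emeasure D B \<le> emeasure (P (k, z)) B"
    proof
      fix B assume "B \<in> sets D"
      hence B: "B \<in> sets (union_measure Psi)" by (simp add: D_def)
      define A where "A = Pair k -` B \<inter> space (Psi k)"
      have A: "A \<in> sets (Psi k)" unfolding A_def by (rule measurable_sets[OF Pair_measurable_union B])
      have "emeasure D B = ennreal c * emeasure (Pk z) A"
        using B pair by (simp add: D_def emeasure_distr A_def sets_eq_imp_space_eq[OF Q(2)])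
      also have "\<dots> = ennreal (c * measure (Pk z) A)"
        using c by (simp add: Q.emeasure_eq_measure ennreal_mult')
      also have "\<dots> \<le> ennreal (measure (P (k, z)) ({k} \<times> A))" by (intro ennreal_leI dom A)
      also have "\<dots> = emeasure (P (k, z)) ({k} \<times> A)" by (simp add: R.emeasure_eq_measure)
      also have "\<dots> \<le> emeasure (P (k, z)) B"
        using B by (intro emeasure_mono) (auto simp: A_def R)
      finally show "emeasure D B \<le> emeasure (P (k, z)) B" .
    qed
  qed
  hence "(\<integral>\<^sup>+x. g x \<partial>D) \<le> (\<integral>\<^sup>+x. g x \<partial>P (k, z))" by (rule nn_integral_mono_measure[OF sets])
  also have "(\<integral>\<^sup>+x. g x \<partial>D) = ennreal c * (\<integral>\<^sup>+z'. g (k, z') \<partial>Pk z)"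
    using g pair by (simp add: D_def nn_integral_scale_measure nn_integral_distr)
  finally show ?thesis .
qed

end

section \<open>The theorem for the disjoint union\<close>

theorem theorem1:
  fixes Psi :: "'k::finite \<Rightarrow> 'z measure"
    and t :: nat
    and P :: "'k \<times> 'z \<Rightarrow> ('k \<times> 'z) measure"
  assumes Psi_fin: "\<And>k. finite_measure (Psi k)"
    and Psi_nonzero: "\<And>k. emeasure (Psi k) (space (Psi k)) \<noteq> 0"
    and P_kernel: "markov_kernel (union_space Psi) P"
    and P_inv: "union_measure Psi \<bind> P = union_measure Psi"
    and t_pos: "t > 0"
    and H1: "\<forall>k. \<exists>Pk :: 'z \<Rightarrow> 'z measure.
               markov_kernel (Psi k) Pk \<and>
               normalize_measure (Psi k) \<bind> Pk = normalize_measure (Psi k) \<and>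
               op_norm (normalize_measure (Psi k)) (kernel_pow (Psi k) Pk t) < 1 \<and>
               (\<exists>c>0. \<forall>z\<in>space (Psi k). \<forall>A\<in>sets (Psi k).
                   measure (P (k, z)) ({k} \<times> A) \<ge> c * measure (Pk z) A)"
    and H2: "\<exists>s::nat. s > 0 \<and> (\<forall>i j. mat_pow (gamma_mat Psi P) s i j > 0)"
  shows "op_norm (union_measure Psi) (kernel_pow (union_space Psi) P t) < 1
         \<and> L2_geometrically_convergent (union_measure Psi) P"
proof -
  interpret nonzero_finite_measures Psi by (intro nonzero_finite_measures.intro Psi_fin Psi_nonzero)
  define U where "U = union_measure Psi"
  define Phi where "Phi k = normalize_measure (Psi k)" for k
  have sets_Phi: "sets (Phi k) = sets (Psi k)" for k by (simp add: Phi_def)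
  have space_Phi: "space (Phi k) = space (Psi k)" for k by (simp add: Phi_def)
  have P: "P \<in> U \<rightarrow>\<^sub>M prob_algebra U"
    using P_kernel prob_algebra_cong_sets[OF sets_union]
    by (simp add: markov_kernel_def U_def sets_union cong: measurable_cong_sets)
  obtain Q where Q: "\<And>k. markov_kernel (Psi k) (Q k)" "\<And>k. Phi k \<bind> Q k = Phi k"
      "\<And>k. op_norm (Phi k) (kernel_pow (Psi k) (Q k) t) < 1"
    and "\<forall>k. \<exists>c>0. \<forall>z\<in>space (Psi k). \<forall>A\<in>sets (Psi k).
           measure (P (k, z)) ({k} \<times> A) \<ge> c * measure (Q k z) A"
    using H1 unfolding Phi_def by metis
  then obtain c where c: "\<And>k. 0 < c k" "\<And>k z A. z \<in> space (Psi k) \<Longrightarrow> A \<in> sets (Psi k) \<Longrightarrow>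
      measure (P (k, z)) ({k} \<times> A) \<ge> c k * measure (Q k z) A"
    by metis
  \<comment> \<open>The smallest of the finitely many constants; lowering a constant preserves
    domination.\<close>
  define c0 where "c0 = Min (range c)"
  have "c0 \<in> range c" unfolding c0_def by (intro Min_in) auto
  hence c0: "0 < c0" using c by auto
  have c0_le: "c0 \<le> c k" for k by (simp add: c0_def)
  interpret mixture weight Phi U
    unfolding U_def Phi_def[abs_def] by (rule mixture_union)
  interpret U: prob_space U unfolding U_def by (rule prob_space_union)
  interpret kernel_on_mixture weight Phi U P Q c0
  proof (rule kernel_on_mixture.intro[OF _ _ kernel_on_mixture_axioms.intro])
    show "mixture weight Phi U" by (rule mixture_axioms)
    show "invariant_kernel U P"
      using P_inv by (intro invariant_kernel.intro U.prob_space_axioms invariant_kernel_axioms.intro P) (simp add: U_def)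
    show "invariant_kernel (Phi k) (Q k)" for k
    proof (intro invariant_kernel.intro prob_component invariant_kernel_axioms.intro)
      show "Q k \<in> Phi k \<rightarrow>\<^sub>M prob_algebra (Phi k)"
        using Q(1)[of k] prob_algebra_cong_sets[OF sets_Phi]
        by (simp add: markov_kernel_def sets_Phi cong: measurable_cong_sets)
      show "Phi k \<bind> Q k = Phi k" by (rule Q)
    qed
    show "0 < c0" by (rule c0)
    fix k z and g :: "'k \<times> 'z \<Rightarrow> ennreal"
    assume z: "z \<in> space (Phi k)" and g: "g \<in> borel_measurable U"
    show "ennreal c0 * (\<integral>\<^sup>+z'. g (k, z') \<partial>Q k z) \<le> (\<integral>\<^sup>+x. g x \<partial>P (k, z))"
    proof (rule domination_nn_integral[OF _ _ c0])
      show "Q k \<in> Psi k \<rightarrow>\<^sub>M prob_algebra (Psi k)" using Q(1) by (simp add: markov_kernel_def)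
      show "P \<in> union_measure Psi \<rightarrow>\<^sub>M prob_algebra (union_measure Psi)" using P by (simp add: U_def)
      show "z \<in> space (Psi k)" using z by (simp add: space_Phi)
      show "g \<in> borel_measurable (union_measure Psi)" using g by (simp add: U_def)
      fix A assume "A \<in> sets (Psi k)"
      hence "c k * measure (Q k z) A \<le> measure (P (k, z)) ({k} \<times> A)"
        using c(2) z by (simp add: space_Phi)
      moreover have "c0 * measure (Q k z) A \<le> c k * measure (Q k z) A"
        using c0_le by (intro mult_right_mono) auto
      ultimately show "c0 * measure (Q k z) A \<le> measure (P (k, z)) ({k} \<times> A)" by linarith
    qed
  qed
  have transition: "0 < transition_mass i j" if "0 < gamma_mat Psi P i j" for i j
  proof -
    have "0 < (\<integral>z. measure (P (i, z)) ({j} \<times> space (Psi j)) \<partial>Psi i)"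
      using that by (simp add: gamma_mat_def split: if_splits)
    moreover have "(\<lambda>z. measure (P (i, z)) ({j} \<times> space (Psi j))) \<in> borel_measurable (Psi i)"
    proof -
      have "{j} \<times> space (Psi j) \<in> sets U" unfolding U_def by (rule times_in_sets_union) simp
      hence "(\<lambda>x. measure (P x) ({j} \<times> space (Psi j))) \<in> borel_measurable U"
        by (intro measurable_compose[OF kernel_subprob measurable_measure_subprob_algebra])
      thus ?thesis
        unfolding U_def by (rule measurable_compose[OF Pair_measurable_union])
    qed
    ultimately show ?thesis
      using integral_normalize_pos[of "\<lambda>z. measure (P (i, z)) ({j} \<times> space (Psi j))" i]
      unfolding transition_mass_def by (simp add: fst_vimage U_def Phi_def)
  qed
  obtain s where s: "0 < s" "\<And>i j. 0 < mat_pow (gamma_mat Psi P) s i j" using H2 by auto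
  have irr: "(h i - h j)\<^sup>2 \<le> 4 ^ s * v"
    if v: "\<And>i j. 0 < transition_mass i j \<Longrightarrow> (h i - h j)\<^sup>2 \<le> v" for i j v and h :: "'k \<Rightarrow> real"
  proof (rule mat_pow_chain[OF v[OF transition] s(2)])
    \<comment> \<open>\<open>v\<close> is arbitrary, so its sign has to be derived: as
      \<open>s > 0\<close>, the positive entry at (i, j) supplies an edge into \<open>j\<close>, and
      \<open>v\<close> bounds a square there.\<close>
    obtain n where n: "s = Suc n" using s(1) gr0_implies_Suc by blast
    have "(\<Sum>l\<in>UNIV. mat_pow (gamma_mat Psi P) n i l * gamma_mat Psi P l j) \<noteq> 0"
      using s(2)[of i j] unfolding n mat_pow.simps by (rule gr_implies_not0)
    then obtain l where "mat_pow (gamma_mat Psi P) n i l * gamma_mat Psi P l j \<noteq> 0" by (meson sum.neutral)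
    hence "(h l - h j)\<^sup>2 \<le> v" by (intro v transition) simp
    thus "0 \<le> v" by (rule order_trans[rotated]) simp
  qed
  have "op_norm U (kernel_pow U P t) < 1"
  proof (rule op_norm_kernel_pow_less_1[OF t_pos _ irr])
    show "op_norm (Phi k) (kernel_pow (Phi k) (Q k) t) < 1" for k
      using Q(3)[of k] kernel_pow_cong_sets[OF sets_Phi] by metis
  qed simp_all
  moreover from this have "L2_geometrically_convergent U P"
    by (rule op_norm_imp_L2_geometrically_convergent[OF t_pos])
  moreover have "kernel_pow (union_space Psi) P t = kernel_pow U P t"
    unfolding U_def by (rule kernel_pow_cong_sets[OF sets_union[symmetric]])
  ultimately show ?thesis by (simp add: U_def)
qed

end
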